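(* Let $\epsilon>0$ be a constant and let $p=\frac{1+\epsilon}{d}$. Then with high probability (i.e. with probability tending to one as $d\to\infty$) the random graph $Q^d_p$ contains a cycle of length $\Omega\left(\frac{2^d}{d^3(\log d)^3}\right)$.
   Context: $Q^d$ denotes the $d$-dimensional hypercube: vertex set $\{0,1\}^d$, two vertices adjacent iff they differ in exactly one coordinate. $Q^d_p$ denotes the random subgraph of $Q^d$ on the same vertex set obtained by retaining each edge of $Q^d$ independently with probability $p$. All asymptotics are as $d\to\infty$; implicit constants may depend on $\epsilon$. *)

theory Defs
  imports "HOL-Probability.Probability"
begin

definition cube_vertices :: "nat \<Rightarrow> bool list set" where
  "cube_vertices d = {xs. length xs = d}"

definition cube_adj :: "nat \<Rightarrow> bool list \<Rightarrow> bool list \<Rightarrow> bool" where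
  "cube_adj d u v \<longleftrightarrow> u \<in> cube_vertices d \<and> v \<in> cube_vertices d \<and>
     card {i. i < d \<and> u ! i \<noteq> v ! i} = 1"

definition cube_edges :: "nat \<Rightarrow> bool list set set" where
  "cube_edges d = {{u, v} | u v. cube_adj d u v}"

definition random_subcube :: "nat \<Rightarrow> real \<Rightarrow> (bool list set \<Rightarrow> bool) pmf" where
  "random_subcube d p = Pi_pmf (cube_edges d) False (\<lambda>_. bernoulli_pmf p)"

definition retained_edges :: "nat \<Rightarrow> (bool list set \<Rightarrow> bool) \<Rightarrow> bool list set set" where
  "retained_edges d G = {e \<in> cube_edges d. G e}"

definition is_cycle :: "'a set set \<Rightarrow> 'a list \<Rightarrow> bool" where
  "is_cycle F vs \<longleftrightarrow> length vs \<ge> 3 \<and> distinct vs \<and>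
     (\<forall>i < length vs. {vs ! i, vs ! ((i + 1) mod length vs)} \<in> F)"

end

theory Submission
  imports Defs "HOL-Real_Asymp.Real_Asymp"
begin

text \<open>
  Expose the edges in two rounds, with probabilities \<open>p1 = (1 + \<epsilon>/2) / d\<close> and \<open>p2 \<ge> \<epsilon> / (2 d)\<close>,
  and let \<open>N = 2 ^ d\<close>, \<open>m\<close> about \<open>d\<^sup>2 ln d\<close>, \<open>t\<close> about \<open>N / (d ln d)\<^sup>3\<close>.

  First round: an exploration martingale together with edge isoperimetry shows that a vertex lies in a
  cluster of size at least \<open>m\<close> with probability bounded away from 0. Applied in disjoint
  subcubes around a vertex, this shows that almost every vertex has at least \<open>\<beta> d\<close> neighbours
  in the set \<open>U\<close> of vertices in large clusters.

  If there is no cycle longer than \<open>t\<close>, a depth-first descent yields a set \<open>W\<close> with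
  \<open>|W \<inter> U|\<close> between \<open>|U|/4\<close> and \<open>|U|/2\<close> whose neighbourhood \<open>Y\<close> has at most \<open>t\<close> vertices. Removing
  \<open>Y\<close> from the first-round graph leaves at most \<open>N/m\<close> clusters of size at least \<open>m\<close>; they cover
  all but \<open>o(N/d)\<close> vertices of \<open>U\<close>, and each lies either inside or outside of \<open>W\<close>. Let \<open>A\<close> and \<open>B\<close> be
  the unions of the two kinds. By isoperimetry there are of order \<open>N/d\<close> disjoint cube edges \<open>{w, x}\<close>
  such that \<open>w\<close> has linearly many neighbours in \<open>A\<close> (or lies in it) and \<open>x\<close> in \<open>B\<close>. Each becomes part of
  an \<open>A\<close>-\<open>B\<close> path avoiding \<open>Y\<close> in the second round with probability of order \<open>1/d\<close>, independently, so
  all fail with probability \<open>exp (- \<Omega>(N/d\<^sup>2))\<close>. This beats the number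
  \<open>exp (O(d t + N/m))\<close> of choices of \<open>Y\<close> and \<open>A\<close>.
\<close>

subsection \<open>Percolation expectations as finite sums\<close>

text \<open>The expectation of \<open>f\<close> over a \<open>p\<close>-random subset of
  \<open>E\<close>, as a polynomial in \<open>p\<close>. Identities then follow by induction on
  \<open>E\<close>; measure theory enters only through \<open>pexp_Pi_pmf\<close>.\<close>

definition pexp :: "real \<Rightarrow> 'e set \<Rightarrow> ('e set \<Rightarrow> real) \<Rightarrow> real" where
  "pexp p E f = (\<Sum>F\<in>Pow E. p ^ card F * (1 - p) ^ card (E - F) * f F)"

lemma pexp_empty [simp]: "pexp p {} f = f {}"
  by (simp add: pexp_def)

text \<open>Condition on whether \<open>e\<close> is retained. All inductions on the edge set rest
  on this recursion.\<close>

lemma pexp_insert: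
  assumes "finite E" "e \<notin> E"
  shows "pexp p (insert e E) f = p * pexp p E (\<lambda>F. f (insert e F)) + (1 - p) * pexp p E f"
proof -
  have inj: "inj_on (insert e) (Pow E)"
    using assms(2) by (auto simp: inj_on_def)
  have "pexp p (insert e E) f =
      (\<Sum>F\<in>Pow E. p ^ card F * (1 - p) ^ card (insert e E - F) * f F) +
      (\<Sum>F\<in>insert e ` Pow E. p ^ card F * (1 - p) ^ card (insert e E - F) * f F)"
    unfolding pexp_def Pow_insert
    using assms by (intro sum.union_disjoint) auto
  also have "(\<Sum>F\<in>insert e ` Pow E. p ^ card F * (1 - p) ^ card (insert e E - F) * f F) =
      (\<Sum>F\<in>Pow E. p * (p ^ card F * (1 - p) ^ card (E - F) * f (insert e F)))"
    unfolding sum.reindex[OF inj] o_def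
  proof (rule sum.cong[OF refl])
    fix F assume F: "F \<in> Pow E"
    then have "finite F" "e \<notin> F" using assms finite_subset by auto
    moreover have "insert e E - insert e F = E - F" using assms F by auto
    ultimately show "p ^ card (insert e F) * (1 - p) ^ card (insert e E - insert e F) * f (insert e F) =
        p * (p ^ card F * (1 - p) ^ card (E - F) * f (insert e F))" by simp
  qed
  also have "(\<Sum>F\<in>Pow E. p ^ card F * (1 - p) ^ card (insert e E - F) * f F) =
      (\<Sum>F\<in>Pow E. (1 - p) * (p ^ card F * (1 - p) ^ card (E - F) * f F))"
  proof (rule sum.cong[OF refl])
    fix F assume F: "F \<in> Pow E"
    then have "insert e E - F = insert e (E - F)" using assms by auto
    then have "card (insert e E - F) = Suc (card (E - F))" using assms by simp
    then show "p ^ card F * (1 - p) ^ card (insert e E - F) * f F =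
        (1 - p) * (p ^ card F * (1 - p) ^ card (E - F) * f F)" by simp
  qed
  finally show ?thesis by (simp add: pexp_def sum_distrib_left)
qed

lemma pexp_cong:
  assumes "\<And>F. F \<subseteq> E \<Longrightarrow> f F = g F"
  shows "pexp p E f = pexp p E g"
  unfolding pexp_def using assms by (intro sum.cong) auto

lemma pexp_mono:
  assumes "0 \<le> p" "p \<le> 1" "\<And>F. F \<subseteq> E \<Longrightarrow> f F \<le> g F"
  shows "pexp p E f \<le> pexp p E g"
  unfolding pexp_def using assms by (intro sum_mono mult_left_mono) auto

lemma pexp_cmult: "pexp p E (\<lambda>F. c * f F) = c * pexp p E f"
  unfolding pexp_def sum_distrib_left by (intro sum.cong) auto

lemma pexp_add: "pexp p E (\<lambda>F. f F + g F) = pexp p E f + pexp p E g"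
  unfolding pexp_def by (simp add: distrib_left sum.distrib)

lemma pexp_diff: "pexp p E (\<lambda>F. f F - g F) = pexp p E f - pexp p E g"
  unfolding pexp_def by (simp add: right_diff_distrib sum_subtractf)

lemma pexp_sum: "pexp p E (\<lambda>F. \<Sum>i\<in>I. f i F) = (\<Sum>i\<in>I. pexp p E (f i))"
  unfolding pexp_def sum_distrib_left by (rule sum.swap)

lemma pexp_const: "finite E \<Longrightarrow> pexp p E (\<lambda>_. c) = c"
  by (induction E rule: finite_induct) (auto simp: pexp_insert algebra_simps)

lemma pexp_nonneg:
  assumes "0 \<le> p" "p \<le> 1" "\<And>F. F \<subseteq> E \<Longrightarrow> 0 \<le> f F"
  shows "0 \<le> pexp p E f"
  unfolding pexp_def using assms by (intro sum_nonneg mult_nonneg_nonneg) auto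

lemma pexp_Un:
  assumes "finite A" "finite B" "A \<inter> B = {}"
  shows "pexp p (A \<union> B) f = pexp p A (\<lambda>F. pexp p B (\<lambda>G. f (F \<union> G)))"
  using assms
proof (induction A arbitrary: f rule: finite_induct)
  case (insert e A)
  then show ?case by (simp add: pexp_insert)
qed simp

lemma pexp_indep:
  assumes "finite A" "finite B" "A \<inter> B = {}"
  shows "pexp p (A \<union> B) (\<lambda>F. f (F \<inter> A) * g (F \<inter> B)) = pexp p A f * pexp p B g"
proof -
  have "pexp p (A \<union> B) (\<lambda>F. f (F \<inter> A) * g (F \<inter> B)) = pexp p A (\<lambda>F. pexp p B (\<lambda>G. f F * g G))"
    unfolding pexp_Un[OF assms]
  proof (intro pexp_cong)
    fix F G assume "F \<subseteq> A" "G \<subseteq> B"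
    then have "(F \<union> G) \<inter> A = F" "(F \<union> G) \<inter> B = G" using assms(3) by auto
    then show "f ((F \<union> G) \<inter> A) * g ((F \<union> G) \<inter> B) = f F * g G" by simp
  qed
  also have "\<dots> = pexp p A f * pexp p B g"
    by (simp add: pexp_cmult[where f=g] mult.commute[where b="pexp p B g"] pexp_cmult)
  finally show ?thesis .
qed

text \<open>Functions of disjoint edge sets are independent: split off \<open>A k\<close>, apply
  \<open>pexp_indep\<close> to it and the remaining edges \<open>B\<close>, and iterate.\<close>

lemma pexp_prod:
  assumes "finite I" "finite E" "\<And>i. i \<in> I \<Longrightarrow> A i \<subseteq> E"
    "\<And>i j. i \<in> I \<Longrightarrow> j \<in> I \<Longrightarrow> i \<noteq> j \<Longrightarrow> A i \<inter> A j = {}"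
  shows "pexp p E (\<lambda>F. \<Prod>i\<in>I. f i (F \<inter> A i)) = (\<Prod>i\<in>I. pexp p (A i) (f i))"
  using assms
proof (induction I arbitrary: E rule: finite_induct)
  case empty
  then show ?case by (simp add: pexp_const)
next
  case (insert k I)
  define B where "B = E - A k"
  have AB: "E = A k \<union> B" "A k \<inter> B = {}" "finite (A k)" "finite B"
    using insert.prems finite_subset[OF _ insert.prems(1)] by (auto simp: B_def)
  have sub: "A i \<subseteq> B" if "i \<in> I" for i
    using insert.prems(2)[of i] insert.prems(3)[of i k] insert.hyps(2) that by (auto simp: B_def)
  have "pexp p E (\<lambda>F. \<Prod>i\<in>insert k I. f i (F \<inter> A i)) =
     pexp p (A k \<union> B) (\<lambda>F. f k (F \<inter> A k) * (\<lambda>G. \<Prod>i\<in>I. f i (G \<inter> A i)) (F \<inter> B))"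
    unfolding AB(1)[symmetric]
  proof (rule pexp_cong)
    fix F assume "F \<subseteq> E"
    have "F \<inter> B \<inter> A i = F \<inter> A i" if "i \<in> I" for i using sub[OF that] by auto
    then show "(\<Prod>i\<in>insert k I. f i (F \<inter> A i)) = f k (F \<inter> A k) * (\<lambda>G. \<Prod>i\<in>I. f i (G \<inter> A i)) (F \<inter> B)"
      using insert.hyps by simp
  qed
  also have "\<dots> = pexp p (A k) (f k) * pexp p B (\<lambda>G. \<Prod>i\<in>I. f i (G \<inter> A i))"
    by (rule pexp_indep) (use AB in auto)
  also have "pexp p B (\<lambda>G. \<Prod>i\<in>I. f i (G \<inter> A i)) = (\<Prod>i\<in>I. pexp p (A i) (f i))"
    using insert.prems sub AB by (intro insert.IH) auto
  finally show ?case using insert.hyps by simp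
qed

text \<open>An edge is missing from \<open>F1 \<union> F2\<close> exactly if both rounds miss it.
  This justifies exposing the graph in two rounds.\<close>

lemma pexp_sprinkle:
  assumes "finite E" "1 - p = (1 - p1) * (1 - p2)"
  shows "pexp p1 E (\<lambda>F1. pexp p2 E (\<lambda>F2. f (F1 \<union> F2))) = pexp p E f"
  using assms(1)
proof (induction E arbitrary: f rule: finite_induct)
  case (insert e E)
  have p: "p = p1 + p2 - p1 * p2" using assms(2) by (simp add: algebra_simps)
  have 1: "pexp p1 E (\<lambda>F1. pexp p2 E (\<lambda>F2. f (insert e (F1 \<union> F2)))) = pexp p E (\<lambda>F. f (insert e F))"
    by (rule insert.IH)
  have 2: "pexp p1 E (\<lambda>F1. pexp p2 E (\<lambda>F2. f (F1 \<union> F2))) = pexp p E f"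
    by (rule insert.IH)
  show ?case using insert.hyps
    by (simp add: pexp_insert pexp_add pexp_cmult 1 2 p) (simp add: algebra_simps)
qed simp

lemma pexp_markov:
  assumes "0 \<le> p" "p \<le> 1" "c > 0" "\<And>F. F \<subseteq> E \<Longrightarrow> 0 \<le> f F"
  shows "pexp p E (\<lambda>F. of_bool (f F > c)) \<le> pexp p E f / c"
proof -
  have "pexp p E (\<lambda>F. of_bool (f F > c)) \<le> pexp p E (\<lambda>F. (1/c) * f F)"
    using assms by (intro pexp_mono) (auto simp: field_simps)
  then show ?thesis by (simp only: pexp_cmult) simp
qed

text \<open>Both sides obey the same recursion when an edge is added, since \<open>Q\<close> depends
  only on the set of retained edges.\<close>

lemma pexp_Pi_pmf:
  assumes "finite E" "0 \<le> p" "p \<le> 1"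
  shows "measure_pmf.prob (Pi_pmf E False (\<lambda>_. bernoulli_pmf p)) {G. Q {e\<in>E. G e}} = pexp p E (\<lambda>F. of_bool (Q F))"
  using assms(1)
proof (induction E arbitrary: Q rule: finite_induct)
  case empty
  show ?case by (simp add: measure_pmf_single measure_return_pmf indicator_def)
next
  case (insert e E)
  let ?P = "\<lambda>E. Pi_pmf E False (\<lambda>_. bernoulli_pmf p)"
  have eq: "{x \<in> insert e E. (G(e := b)) x} = (if b then insert e {x\<in>E. G x} else {x\<in>E. G x})" for G b
    using insert.hyps by auto
  have bind: "?P (insert e E) = bernoulli_pmf p \<bind> (\<lambda>b. map_pmf (\<lambda>G. G(e := b)) (?P E))"
    unfolding Pi_pmf_insert'[OF insert.hyps] by (simp add: map_pmf_def)
  have fin: "finite (set_pmf (?P E))"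
    using insert.hyps by (intro finite_subset[OF set_Pi_pmf_subset'] finite_PiE_dflt) auto
  define S where "S = {G. Q {x\<in>insert e E. G x}}"
  have pre: "(\<lambda>G. G(e := b)) -` S =
      {G. Q (if b then insert e {x\<in>E. G x} else {x\<in>E. G x})}" for b
    unfolding S_def vimage_def mem_Collect_eq eq ..
  have "measure_pmf.prob (?P (insert e E)) S =
     measure_pmf.expectation (bernoulli_pmf p \<bind> (\<lambda>b. map_pmf (\<lambda>G. G(e := b)) (?P E))) (indicat_real S)"
    by (simp add: bind)
  also have "\<dots> = (\<Sum>b\<in>UNIV. pmf (bernoulli_pmf p) b *\<^sub>R
      measure_pmf.expectation (map_pmf (\<lambda>G. G(e := b)) (?P E)) (indicat_real S))"
    using fin by (intro pmf_expectation_bind) auto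
  also have "\<dots> = p * measure_pmf.prob (?P E) {G. Q (insert e {x\<in>E. G x})} +
     (1 - p) * measure_pmf.prob (?P E) {G. Q {x\<in>E. G x}}"
    using assms by (simp add: UNIV_bool pre)
  also have "measure_pmf.prob (?P E) {G. Q (insert e {x\<in>E. G x})} = pexp p E (\<lambda>F. of_bool (Q (insert e F)))"
    by (rule insert.IH)
  also have "measure_pmf.prob (?P E) {G. Q {x\<in>E. G x}} = pexp p E (\<lambda>F. of_bool (Q F))"
    by (rule insert.IH)
  finally show ?case using insert.hyps by (simp add: pexp_insert S_def)
qed

subsection \<open>Exploring a cluster\<close>

definition conn :: "'a set set \<Rightarrow> 'a rel" where
  "conn F = {(x, y). {x, y} \<in> F}"

text \<open>\<open>R\<close> is a set of roots rather than a single vertex, so that the exploration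
  can enlarge it step by step.\<close>

definition cluster :: "'a set set \<Rightarrow> 'a set \<Rightarrow> 'a set" where
  "cluster F R = (conn F)\<^sup>* `` R"

definition boundary :: "'a set set \<Rightarrow> 'a set \<Rightarrow> 'a set set" where
  "boundary E S = {e \<in> E. \<exists>x y. e = {x, y} \<and> x \<in> S \<and> y \<notin> S}"

lemma cluster_superset: "R \<subseteq> cluster F R"
  by (auto simp: cluster_def)

lemma cluster_closed: "x \<in> cluster F R \<Longrightarrow> {x, y} \<in> F \<Longrightarrow> y \<in> cluster F R"
  unfolding cluster_def conn_def by (blast intro: rtrancl_into_rtrancl)

lemma cluster_least:
  assumes "R \<subseteq> S" "\<And>x y. x \<in> S \<Longrightarrow> {x, y} \<in> F \<Longrightarrow> y \<in> S"
  shows "cluster F R \<subseteq> S"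
proof
  fix z assume "z \<in> cluster F R"
  then obtain x where x: "x \<in> R" "(x, z) \<in> (conn F)\<^sup>*" by (auto simp: cluster_def)
  from x(2) show "z \<in> S"
    by (induction rule: rtrancl_induct) (use x(1) assms in \<open>auto simp: conn_def\<close>)
qed

lemma cluster_mono: "F \<subseteq> F' \<Longrightarrow> R \<subseteq> R' \<Longrightarrow> cluster F R \<subseteq> cluster F' R'"
  by (rule cluster_least) (meson cluster_superset subset_trans, meson cluster_closed subsetD)

lemma cluster_subset_Union: "cluster F R \<subseteq> R \<union> \<Union>F"
  by (rule cluster_least) auto

lemma finite_cluster: "finite R \<Longrightarrow> finite (\<Union>F) \<Longrightarrow> finite (cluster F R)"
  using cluster_subset_Union finite_subset by (metis finite_UnI)

lemma cluster_sym:
  assumes "y \<in> cluster F {x}"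
  shows "x \<in> cluster F {y}"
proof -
  have "sym (conn F)" by (auto simp: conn_def sym_def insert_commute)
  then have "sym ((conn F)\<^sup>*)" by (rule sym_rtrancl)
  then show ?thesis using assms by (auto simp: cluster_def sym_def)
qed

lemma cluster_subset_cluster: "y \<in> cluster F {x} \<Longrightarrow> cluster F {y} \<subseteq> cluster F {x}"
  by (rule cluster_least) (use cluster_closed in auto)

lemma cluster_eq: "y \<in> cluster F {x} \<Longrightarrow> cluster F {y} = cluster F {x}"
  using cluster_sym cluster_subset_cluster by (metis subset_antisym)

lemma cluster_self [simp]: "x \<in> cluster F {x}"
  using cluster_superset by fastforce

text \<open>An open edge from \<open>R\<close> to \<open>u\<close> serves only to make
  \<open>u\<close> reachable, so it may be forgotten once \<open>u\<close> is a root.\<close>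

lemma cluster_insert_edge:
  assumes "r \<in> R"
  shows "cluster (insert {r, u} F) R = cluster F (insert u R)" (is "?A = ?B")
proof
  show "?A \<subseteq> ?B"
  proof (rule cluster_least)
    fix x y assume "x \<in> ?B" "{x, y} \<in> insert {r, u} F"
    moreover have "r \<in> ?B" "u \<in> ?B" using cluster_superset assms by fastforce+
    ultimately show "y \<in> ?B" by (auto simp: doubleton_eq_iff intro: cluster_closed)
  qed (use cluster_superset in fastforce)
  have "r \<in> ?A" using assms cluster_superset by fastforce
  then have "u \<in> ?A" by (rule cluster_closed) simp
  then show "?B \<subseteq> ?A"
    by (intro cluster_least) (auto intro: subsetD[OF cluster_superset] cluster_closed)
qed

text \<open>
  Reveal the edges leaving \<open>R\<close> one at a time: an open edge adds a vertex and multiplies the weight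
  by \<open>a\<close>, a closed one joins the boundary and multiplies it by \<open>b\<close>, so the weight is a
  supermartingale.
\<close>

lemma pexp_exploration:
  fixes a b p :: real
  assumes "finite E" "\<And>e. e \<in> E \<Longrightarrow> \<exists>x y. e = {x, y}" "finite R"
    and p: "0 \<le> p" "p \<le> 1" and ab: "0 < a" "1 \<le> b" "p * a + (1 - p) * b \<le> 1"
  shows "pexp p E (\<lambda>F. a ^ card (cluster F R - R) * b ^ card (boundary E (cluster F R))) \<le> 1"
  using assms(1-3)
proof (induction "card E" arbitrary: E R)
  case 0
  then have "E = {}" by simp
  moreover have "cluster {} R = R"
    using cluster_superset[of R "{}"] cluster_subset_Union[of "{}" R] by auto
  ultimately show ?case by (simp add: boundary_def)
next
  case (Suc n)
  show ?case
  \<comment> \<open>If no unrevealed edge leaves \<open>R\<close>, the exploration is over: the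
    cluster is \<open>R\<close> and the weight is 1.\<close>
  proof (cases "boundary E R = {}")
    case True
    have "cluster F R = R" if "F \<subseteq> E" for F
    proof
      show "cluster F R \<subseteq> R"
        by (rule cluster_least) (use True that in \<open>auto simp: boundary_def\<close>)
    qed (rule cluster_superset)
    then have "pexp p E (\<lambda>F. a ^ card (cluster F R - R) * b ^ card (boundary E (cluster F R)))
        = pexp p E (\<lambda>F. 1)"
      by (intro pexp_cong) (simp add: True)
    then show ?thesis using Suc.prems by (simp add: pexp_const)
  next
    case False
    then obtain r u where e: "{r, u} \<in> E" "r \<in> R" "u \<notin> R" by (auto simp: boundary_def)
    define E' where "E' = E - {{r, u}}"
    have E: "E = insert {r, u} E'" "{r, u} \<notin> E'" using e by (auto simp: E'_def)
    have E': "n = card E'" "finite E'" "\<And>e. e \<in> E' \<Longrightarrow> \<exists>x y. e = {x, y}"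
      using Suc.prems Suc.hyps(2) e by (auto simp: E'_def)
    have finU: "finite (\<Union>F)" if "F \<subseteq> E'" for F
      using that E'(2,3) by (metis finite_Union finite.emptyI finite.insertI finite_subset subsetD)
    let ?g = "\<lambda>E R F. a ^ card (cluster F R - R) * b ^ card (boundary E (cluster F R))"
    \<comment> \<open>Open edge: \<open>u\<close> becomes a root, which costs one factor
      \<open>a\<close>, and \<open>{r, u}\<close> lies inside the cluster, so the boundary is
      unchanged.\<close>
    have "pexp p E' (\<lambda>F. ?g E R (insert {r, u} F)) = pexp p E' (\<lambda>F. a * ?g E' (insert u R) F)"
    proof (rule pexp_cong)
      fix F assume F: "F \<subseteq> E'"
      let ?C = "cluster F (insert u R)"
      have sup: "insert u R \<subseteq> ?C" by (rule cluster_superset)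
      have fin: "finite ?C" using finU[OF F] Suc.prems(3) by (intro finite_cluster) auto
      have "?C - R = insert u (?C - insert u R)" using sup e by auto
      then have "card (?C - R) = Suc (card (?C - insert u R))"
        using fin by (metis Diff_iff card_insert_disjoint finite_Diff insertI1)
      moreover have "boundary E ?C = boundary E' ?C"
        using sup e by (auto simp: boundary_def E'_def doubleton_eq_iff)
      ultimately show "?g E R (insert {r, u} F) = a * ?g E' (insert u R) F"
        using cluster_insert_edge[OF e(2)] by simp
    qed
    also have "\<dots> = a * pexp p E' (?g E' (insert u R))" by (rule pexp_cmult)
    also have "\<dots> \<le> a * 1"
      using ab Suc.prems Suc.hyps(1)[OF E'(1)] E' by (intro mult_left_mono) auto
    finally have 1: "pexp p E' (\<lambda>F. ?g E R (insert {r, u} F)) \<le> a" by simp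
    \<comment> \<open>Closed edge: \<open>{r, u}\<close> adds at most one boundary edge. It adds
      none if \<open>u\<close> is reached in another way, and \<open>1 \<le> b\<close> covers both
      cases.\<close>
    have "pexp p E' (?g E R) \<le> pexp p E' (\<lambda>F. b * ?g E' R F)"
    proof (intro pexp_mono p)
      fix F assume "F \<subseteq> E'"
      let ?C = "cluster F R"
      have "boundary E ?C \<subseteq> insert {r, u} (boundary E' ?C)"
        by (auto simp: boundary_def E'_def)
      moreover have "finite (boundary E' ?C)" using E' by (simp add: boundary_def)
      ultimately have "card (boundary E ?C) \<le> Suc (card (boundary E' ?C))"
        by (metis card_insert_le_m1 card_mono finite_insert le_SucI card_insert_if)
      then have "b ^ card (boundary E ?C) \<le> b ^ Suc (card (boundary E' ?C))"
        using ab by (intro power_increasing) auto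
      then have "a ^ card (?C - R) * b ^ card (boundary E ?C)
          \<le> a ^ card (?C - R) * b ^ Suc (card (boundary E' ?C))"
        using ab by (intro mult_left_mono) auto
      then show "?g E R F \<le> b * ?g E' R F" by (simp add: mult_ac)
    qed
    also have "\<dots> = b * pexp p E' (?g E' R)" by (rule pexp_cmult)
    also have "\<dots> \<le> b * 1"
      using ab Suc.prems Suc.hyps(1)[OF E'(1)] E' by (intro mult_left_mono) auto
    finally have 2: "pexp p E' (?g E R) \<le> b" by simp
    have "pexp p E (?g E R) = p * pexp p E' (\<lambda>F. ?g E R (insert {r, u} F)) + (1 - p) * pexp p E' (?g E R)"
      unfolding E(1) using pexp_insert[OF E'(2) E(2)] by (simp flip: E(1))
    also have "\<dots> \<le> p * a + (1 - p) * b"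
      using 1 2 p by (intro add_mono mult_left_mono) auto
    finally show ?thesis using ab by simp
  qed
qed

text \<open>Markov's inequality for the exploration weight with \<open>a = 1 / r\<close> and
  \<open>b = 1 + p * (1 - 1 / r)\<close>. Bernoulli's inequality gives \<open>r \<le> b ^ n\<close>,
  so a cluster of \<open>j < m\<close> vertices, having at least \<open>n * j\<close> boundary
  edges, has weight at least \<open>(1 / r) ^ (j - 1) * r ^ j = r\<close>.\<close>

lemma cluster_large_prob:
  fixes p r :: real and n m :: nat
  assumes E: "finite E" "\<And>e. e \<in> E \<Longrightarrow> \<exists>x y. e = {x, y}"
    and p: "0 \<le> p" "p \<le> 1" and r: "1 \<le> r" "r \<le> real n * p"
    and exp: "\<And>S. finite S \<Longrightarrow> v \<in> S \<Longrightarrow> S \<subseteq> cluster E {v} \<Longrightarrow> card S < m \<Longrightarrow> n * card S \<le> card (boundary E S)"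
  shows "pexp p E (\<lambda>F. of_bool (card (cluster F {v}) < m)) \<le> 1 / r"
proof -
  define a where "a = 1 / r"
  define b where "b = 1 + p * (1 - 1 / r)"
  have a: "0 < a" and b: "1 \<le> b" using r p by (auto simp: a_def b_def)
  have "p * a + (1 - p) * b = 1 - p ^ 2 * (1 - 1 / r)"
    using r by (simp add: a_def b_def field_simps power2_eq_square)
  then have ab: "p * a + (1 - p) * b \<le> 1" using r p by simp
  have "r = 1 + r * (1 - 1 / r)" using r by (simp add: field_simps)
  also have "\<dots> \<le> 1 + (real n * p) * (1 - 1 / r)"
    using r by (intro add_left_mono mult_right_mono) auto
  also have "\<dots> = 1 + real n * (p * (1 - 1 / r))" by simp
  also have "\<dots> \<le> b ^ n" unfolding b_def
    using r p by (intro Bernoulli_inequality) (smt (verit) divide_le_eq_1_pos mult_nonneg_nonneg)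
  finally have bn: "r \<le> b ^ n" .
  let ?g = "\<lambda>F. a ^ card (cluster F {v} - {v}) * b ^ card (boundary E (cluster F {v}))"
  have "pexp p E (\<lambda>F. of_bool (card (cluster F {v}) < m)) \<le> pexp p E (\<lambda>F. (1 / r) * ?g F)"
  proof (intro pexp_mono p)
    fix F assume F: "F \<subseteq> E"
    let ?C = "cluster F {v}"
    show "of_bool (card ?C < m) \<le> (1 / r) * ?g F"
    proof (cases "card ?C < m")
      case True
      have "finite (\<Union>F)" using F E
        by (metis finite_Union finite.emptyI finite.insertI finite_subset subsetD)
      then have fin: "finite ?C" by (simp add: finite_cluster)
      have "?C \<subseteq> cluster E {v}" using F by (intro cluster_mono) auto
      then have "n * card ?C \<le> card (boundary E ?C)" using exp True fin by simp
      then have "b ^ (n * card ?C) \<le> b ^ card (boundary E ?C)" using b by (intro power_increasing)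
      moreover have "r ^ card ?C \<le> b ^ (n * card ?C)"
        using power_mono[OF bn, of "card ?C"] r by (simp add: power_mult)
      ultimately have 1: "r ^ card ?C \<le> b ^ card (boundary E ?C)" by simp
      have "card ?C = Suc (card (?C - {v}))"
        using fin by (metis card_Suc_Diff1 cluster_self)
      moreover have "r = a ^ k * r ^ Suc k" for k
        using r by (simp add: a_def power_one_over)
      ultimately have "r = a ^ card (?C - {v}) * r ^ card ?C" by metis
      also have "\<dots> \<le> ?g F" using a 1 by (intro mult_left_mono) auto
      finally show ?thesis using True r by (simp add: field_simps)
    next
      case False
      then show ?thesis using a b r by simp
    qed
  qed
  also have "\<dots> = (1 / r) * pexp p E ?g" by (rule pexp_cmult)
  also have "\<dots> \<le> (1 / r) * 1"
    using r E p a b ab by (intro mult_left_mono pexp_exploration) auto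
  finally show ?thesis by simp
qed

subsection \<open>The cube\<close>

definition flip :: "bool list \<Rightarrow> nat \<Rightarrow> bool list" where
  "flip x i = x[i := \<not> x ! i]"

text \<open>Only \<open>x\<close> is required to lie in \<open>Q\<close>; in the uses below
  \<open>Q\<close> is closed under flips in the directions \<open>J\<close>, so these are the edges
  of a subcube.\<close>

definition dir_edges :: "bool list set \<Rightarrow> nat set \<Rightarrow> bool list set set" where
  "dir_edges Q J = {{x, flip x j} | x j. x \<in> Q \<and> j \<in> J}"

lemma length_flip [simp]: "length (flip x i) = length x"
  by (simp add: flip_def)

lemma flip_nth: "i < length x \<Longrightarrow> flip x i ! j = (if i = j then \<not> x ! j else x ! j)"
  by (auto simp: flip_def nth_list_update)

lemma flip_flip [simp]: "flip (flip x i) i = x"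
  by (cases "i < length x") (simp_all add: flip_def list_update_beyond)

lemma flip_Cons_0 [simp]: "flip (b # x) 0 = (\<not> b) # x"
  by (simp add: flip_def)

lemma flip_Cons_Suc [simp]: "flip (b # x) (Suc i) = b # flip x i"
  by (simp add: flip_def)

lemma flip_inj: "i < length x \<Longrightarrow> j < length x \<Longrightarrow> flip x i = flip x j \<Longrightarrow> i = j"
  using flip_nth[of i x i] flip_nth[of j x i] by metis

lemma flip_in_cube [simp]: "flip x i \<in> cube_vertices d \<longleftrightarrow> x \<in> cube_vertices d"
  by (simp add: cube_vertices_def)

lemma finite_cube_vertices [simp]: "finite (cube_vertices d)"
  using finite_lists_length_eq[of "UNIV :: bool set" d] by (simp add: cube_vertices_def)

lemma card_cube_vertices: "card (cube_vertices d) = 2 ^ d"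
  using card_lists_length_eq[of "UNIV :: bool set" d] by (simp add: cube_vertices_def)

lemma cube_adj_iff: "cube_adj d u v \<longleftrightarrow> u \<in> cube_vertices d \<and> (\<exists>i<d. v = flip u i)"
proof
  assume adj: "cube_adj d u v"
  then obtain i where i: "{i. i < d \<and> u ! i \<noteq> v ! i} = {i}"
    unfolding cube_adj_def by (metis card_1_singletonE)
  then have "i < d" by blast
  moreover have "v = flip u i"
  proof (rule nth_equalityI)
    show "length v = length (flip u i)" using adj by (simp add: cube_adj_def cube_vertices_def)
    fix j assume "j < length v"
    then have j: "j < d" "length u = d" using adj by (auto simp: cube_adj_def cube_vertices_def)
    have "u ! j \<noteq> v ! j \<longleftrightarrow> j = i" using i j(1) by blast
    then show "v ! j = flip u i ! j"
      using j \<open>i < d\<close> by (cases "j = i") (simp_all add: flip_nth)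
  qed
  ultimately show "u \<in> cube_vertices d \<and> (\<exists>i<d. v = flip u i)"
    using adj by (auto simp: cube_adj_def)
next
  assume R: "u \<in> cube_vertices d \<and> (\<exists>i<d. v = flip u i)"
  then obtain i where i: "i < d" "v = flip u i" "length u = d" by (auto simp: cube_vertices_def)
  then have "{j. j < d \<and> u ! j \<noteq> v ! j} = {i}" by (auto simp: flip_nth)
  then show "cube_adj d u v" using R i by (auto simp: cube_adj_def)
qed

lemma cube_edges_eq: "cube_edges d = dir_edges (cube_vertices d) {..<d}"
  unfolding cube_edges_def dir_edges_def cube_adj_iff by blast

lemma finite_dir_edges: "finite Q \<Longrightarrow> finite J \<Longrightarrow> finite (dir_edges Q J)"
proof -
  assume "finite Q" "finite J"
  moreover have "dir_edges Q J = (\<lambda>(x, j). {x, flip x j}) ` (Q \<times> J)"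
    by (auto simp: dir_edges_def)
  ultimately show ?thesis by simp
qed

lemma finite_cube_edges [simp]: "finite (cube_edges d)"
  unfolding cube_edges_eq by (intro finite_dir_edges) auto

lemma dir_edges_mono: "Q \<subseteq> Q' \<Longrightarrow> J \<subseteq> J' \<Longrightarrow> dir_edges Q J \<subseteq> dir_edges Q' J'"
  by (auto simp: dir_edges_def)

lemma cube_edgesD:
  assumes "{x, y} \<in> cube_edges d"
  shows "x \<in> cube_vertices d" "\<exists>i<d. y = flip x i"
proof -
  obtain z i where z: "{x, y} = {z, flip z i}" "z \<in> cube_vertices d" "i < d"
    using assms by (auto simp: cube_edges_eq dir_edges_def)
  then show "x \<in> cube_vertices d" by (auto simp: doubleton_eq_iff)
  show "\<exists>i<d. y = flip x i" using z by (auto simp: doubleton_eq_iff)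
qed

lemma cube_edge_flip: "x \<in> cube_vertices d \<Longrightarrow> i < d \<Longrightarrow> {x, flip x i} \<in> cube_edges d"
  by (auto simp: cube_edges_eq dir_edges_def)

section \<open>Edge isoperimetry in the cube\<close>

lemma log2_one_plus_ge:
  fixes t :: real assumes "0 \<le> t" "t \<le> 1"
  shows "t \<le> log 2 (1 + t)"
proof -
  have "- log 2 ((1 - t) *\<^sub>R 1 + t *\<^sub>R 2) \<le> (1 - t) * (- log 2 1) + t * (- log 2 2)"
    by (rule convex_onD[OF minus_log_convex[of 2]]) (use assms in auto)
  then show ?thesis by (simp add: algebra_simps)
qed

text \<open>With \<open>n = x + y\<close> the claim says that
  \<open>x * log 2 (n / x) + y * log 2 (n / y)\<close> is at least \<open>2 * x\<close>. Each
  summand is at least \<open>x\<close>: the first because \<open>n / x \<ge> 2\<close>, the second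
  by concavity of the logarithm.\<close>

lemma log2_superadditive_pos:
  fixes x y :: real assumes "0 < x" "x \<le> y"
  shows "x * log 2 x + y * log 2 y + 2 * x \<le> (x + y) * log 2 (x + y)"
proof -
  have "1 = log 2 2" by simp
  also have "\<dots> \<le> log 2 (1 + y / x)" using assms by (subst log_le_cancel_iff) (auto intro: add_pos_nonneg)
  also have "1 + y / x = (x + y) / x" using assms by (simp add: field_simps)
  also have "log 2 \<dots> = log 2 (x + y) - log 2 x" using assms by (simp add: log_divide)
  finally have 1: "x \<le> x * (log 2 (x + y) - log 2 x)" using assms by simp
  have "x / y \<le> log 2 (1 + x / y)" using assms by (intro log2_one_plus_ge) auto
  also have "1 + x / y = (x + y) / y" using assms by (simp add: field_simps)
  also have "log 2 \<dots> = log 2 (x + y) - log 2 y" using assms by (simp add: log_divide)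
  finally have "y * (x / y) \<le> y * (log 2 (x + y) - log 2 y)"
    using assms by (intro mult_left_mono) auto
  then have 2: "x \<le> y * (log 2 (x + y) - log 2 y)" using assms by simp
  from 1 2 show ?thesis by (simp add: algebra_simps)
qed

lemma log2_superadditive:
  fixes m n :: nat
  shows "m * log 2 m + n * log 2 n + 2 * min m n \<le> (m + n) * log 2 (m + n)"
proof -
  consider "m = 0" | "n = 0" | "0 < m" "m \<le> n" | "0 < n" "n \<le> m" by linarith
  then show ?thesis
  proof cases
    case 3
    then show ?thesis using log2_superadditive_pos[of m n] by (simp add: min_def)
  next
    case 4
    then show ?thesis using log2_superadditive_pos[of n m]
      by (auto simp: min_def add_ac)
  qed auto
qed

text \<open>The left side counts every edge inside \<open>S\<close> twice. Split \<open>S\<close> by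
  its first coordinate into \<open>S0\<close> and \<open>S1\<close>: the edges across contribute
  \<open>2 * card (S0 \<inter> S1)\<close>, which is exactly the slack that
  \<open>log2_superadditive\<close> provides.\<close>

lemma inner_degree_sum_le:
  assumes "S \<subseteq> cube_vertices d"
  shows "(\<Sum>x\<in>S. \<Sum>i<d. of_bool (flip x i \<in> S) :: real) \<le> card S * log 2 (card S)"
  using assms
proof (induction d arbitrary: S)
  case 0
  then have "S = {} \<or> S = {[]}" by (auto simp: cube_vertices_def)
  then show ?case by auto
next
  case (Suc d)
  define S0 where "S0 = {x. False # x \<in> S}"
  define S1 where "S1 = {x. True # x \<in> S}"
  have sub: "S0 \<subseteq> cube_vertices d" "S1 \<subseteq> cube_vertices d"
    using Suc.prems by (auto simp: S0_def S1_def cube_vertices_def)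
  have fin: "finite S0" "finite S1" using sub finite_subset finite_cube_vertices by blast+
  have S: "S = (#) False ` S0 \<union> (#) True ` S1"
  proof
    show "S \<subseteq> (#) False ` S0 \<union> (#) True ` S1"
    proof
      fix x assume x: "x \<in> S"
      then obtain b y where "x = b # y" using Suc.prems
        by (cases x) (auto simp: cube_vertices_def)
      then show "x \<in> (#) False ` S0 \<union> (#) True ` S1"
        using x by (cases b) (auto simp: S0_def S1_def)
    qed
  qed (auto simp: S0_def S1_def)
  have disj: "(#) False ` S0 \<inter> (#) True ` S1 = {}" by auto
  have card: "card S = card S0 + card S1"
    using fin by (simp add: S card_Un_disjoint[OF _ _ disj] card_image)
  have split: "(\<Sum>x\<in>S. f x) = (\<Sum>x\<in>S0. f (False # x)) + (\<Sum>x\<in>S1. f (True # x))" for f :: "_ \<Rightarrow> real"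
    using fin by (simp add: S sum.union_disjoint[OF _ _ disj] sum.reindex)
  have m0: "(\<Sum>i<Suc d. of_bool (flip (False # x) i \<in> S)) = of_bool (x \<in> S1) + (\<Sum>i<d. of_bool (flip x i \<in> S0) :: real)" for x
    by (simp add: sum.lessThan_Suc_shift S0_def S1_def del: sum.lessThan_Suc)
  have m1: "(\<Sum>i<Suc d. of_bool (flip (True # x) i \<in> S)) = of_bool (x \<in> S0) + (\<Sum>i<d. of_bool (flip x i \<in> S1) :: real)" for x
    by (simp add: sum.lessThan_Suc_shift S0_def S1_def del: sum.lessThan_Suc)
  have c: "(\<Sum>x\<in>A. of_bool (x \<in> B)) = real (card (A \<inter> B))" if "finite A" for A B :: "bool list set"
    using that by (simp add: of_bool_def sum.If_cases)
  have "(\<Sum>x\<in>S. \<Sum>i<Suc d. of_bool (flip x i \<in> S)) =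
     2 * real (card (S0 \<inter> S1)) + (\<Sum>x\<in>S0. \<Sum>i<d. of_bool (flip x i \<in> S0)) + (\<Sum>x\<in>S1. \<Sum>i<d. of_bool (flip x i \<in> S1))"
    unfolding split m0 m1 using fin by (simp add: sum.distrib c Int_commute)
  also have "\<dots> \<le> 2 * min (card S0) (card S1) + card S0 * log 2 (card S0) + card S1 * log 2 (card S1)"
    using fin by (intro add_mono Suc.IH sub) (auto simp: card_mono)
  also have "\<dots> \<le> card S * log 2 (card S)"
    using log2_superadditive[of "card S0" "card S1"] by (simp add: card)
  finally show ?case .
qed

text \<open>Each vertex of \<open>S\<close> has \<open>card J\<close> edges in the directions
  \<open>J\<close>; those that stay inside \<open>S\<close> are bounded by
  \<open>inner_degree_sum_le\<close>. A boundary edge determines its endpoint in \<open>S\<close>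
  and its direction, so none is counted twice.\<close>

lemma card_boundary_ge:
  assumes "S \<subseteq> Q" "Q \<subseteq> cube_vertices d" "J \<subseteq> {..<d}"
  shows "card S * (card J - log 2 (card S)) \<le> card (boundary (dir_edges Q J) S)"
proof -
  have fin: "finite S" "finite J" "finite Q" using assms finite_subset[of _ "cube_vertices d"]
    by (auto intro: finite_subset)
  define P where "P = (SIGMA x:S. {j\<in>J. flip x j \<notin> S})"
  have len: "j < length x" if "x \<in> S" "j \<in> J" for x j
    using that assms by (auto simp: cube_vertices_def)
  have "inj_on (\<lambda>(x, j). {x, flip x j}) P"
  proof (rule inj_onI, clarify)
    fix x i y j assume *: "(x, i) \<in> P" "(y, j) \<in> P" "{x, flip x i} = {y, flip y j}"
    then have xy: "x = y" "flip x i = flip y j" by (auto simp: P_def doubleton_eq_iff)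
    moreover have "i = j" using * xy by (intro flip_inj[of i x j] len) (auto simp: P_def)
    ultimately show "x = y \<and> i = j" by simp
  qed
  moreover have "(\<lambda>(x, j). {x, flip x j}) ` P \<subseteq> boundary (dir_edges Q J) S"
  proof clarify
    fix x j assume "(x, j) \<in> P"
    then have "x \<in> S" "j \<in> J" "flip x j \<notin> S" by (auto simp: P_def)
    moreover from this have "{x, flip x j} \<in> dir_edges Q J"
      using assms by (auto simp: dir_edges_def)
    ultimately show "{x, flip x j} \<in> boundary (dir_edges Q J) S"
      unfolding boundary_def by blast
  qed
  moreover have "finite (boundary (dir_edges Q J) S)"
    using finite_dir_edges[OF fin(3,2)] by (simp add: boundary_def)
  ultimately have "card P \<le> card (boundary (dir_edges Q J) S)" by (rule card_inj_on_le)
  moreover have "real (card P) = card S * card J - (\<Sum>x\<in>S. \<Sum>j\<in>J. of_bool (flip x j \<in> S) :: real)"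
  proof -
    have "real (card {j\<in>J. flip x j \<notin> S}) = card J - (\<Sum>j\<in>J. of_bool (flip x j \<in> S) :: real)" for x
    proof -
      have "real (card {j\<in>J. flip x j \<notin> S}) = (\<Sum>j\<in>J. of_bool (flip x j \<notin> S))"
        using fin by (simp add: of_bool_def sum.If_cases Int_def)
      also have "\<dots> = (\<Sum>j\<in>J. 1 - of_bool (flip x j \<in> S))" by (intro sum.cong) auto
      finally show ?thesis by (simp add: sum_subtractf)
    qed
    then show ?thesis using fin by (simp add: P_def sum_subtractf)
  qed
  moreover have "(\<Sum>x\<in>S. \<Sum>j\<in>J. of_bool (flip x j \<in> S)) \<le> (\<Sum>x\<in>S. \<Sum>i<d. of_bool (flip x i \<in> S) :: real)"
    using assms by (intro sum_mono sum_mono2) auto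
  moreover have "\<dots> \<le> card S * log 2 (card S)"
    using assms by (intro inner_degree_sum_le) auto
  ultimately show ?thesis by (simp add: algebra_simps)
qed

subsection \<open>The first round of exposure\<close>

definition large :: "nat \<Rightarrow> nat \<Rightarrow> bool list set set \<Rightarrow> bool list set" where
  "large d m F = {x \<in> cube_vertices d. m \<le> card (cluster F {x})}"

text \<open>Neighbours are recorded by their directions, which are distinct for distinct neighbours
  of a cube vertex.\<close>

definition nbrs_in :: "nat \<Rightarrow> bool list \<Rightarrow> bool list set \<Rightarrow> nat set" where
  "nbrs_in d x A = {i. i < d \<and> flip x i \<in> A}"

definition atypical :: "nat \<Rightarrow> nat \<Rightarrow> real \<Rightarrow> bool list set set \<Rightarrow> bool list set" where
  "atypical d m k F = {w \<in> cube_vertices d. real (card (nbrs_in d w (large d m F))) < k}"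

definition open_degree :: "nat \<Rightarrow> bool list set set \<Rightarrow> bool list \<Rightarrow> nat" where
  "open_degree d F x = card {i. i < d \<and> {x, flip x i} \<in> F}"

lemma finite_nbrs_in [simp]: "finite (nbrs_in d x A)"
  by (simp add: nbrs_in_def)

lemma prod_if_one:
  assumes "finite I"
  shows "(\<Prod>i\<in>I. if P i then c else 1) = (c :: real) ^ card {i \<in> I. P i}"
  using prod.inter_filter[OF assms, of "\<lambda>_. c" P] by simp

lemma cube_edges_doubleton: "e \<in> cube_edges d \<Longrightarrow> \<exists>x y. e = {x, y}"
  by (auto simp: cube_edges_eq dir_edges_def)

lemma cluster_subset_cube:
  assumes "F \<subseteq> cube_edges d" "R \<subseteq> cube_vertices d"
  shows "cluster F R \<subseteq> cube_vertices d"
proof (rule cluster_least[OF assms(2)])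
  fix x y assume "x \<in> cube_vertices d" "{x, y} \<in> F"
  then have "{y, x} \<in> cube_edges d" using assms by (auto simp: insert_commute)
  then show "y \<in> cube_vertices d" by (rule cube_edgesD)
qed

text \<open>
  The \<open>i\<close>-th branch at \<open>w\<close> is a subcube of dimension \<open>d - 1 - i\<close> containing \<open>flip w i\<close>; distinct branches
  are disjoint, so their clusters are independent.
\<close>

definition branch_vertices :: "nat \<Rightarrow> bool list \<Rightarrow> nat \<Rightarrow> bool list set" where
  "branch_vertices d w i = {x \<in> cube_vertices d. (\<forall>j<i. x ! j = w ! j) \<and> x ! i \<noteq> w ! i}"

definition branch_edges :: "nat \<Rightarrow> bool list \<Rightarrow> nat \<Rightarrow> bool list set set" where
  "branch_edges d w i = dir_edges (branch_vertices d w i) {i<..<d}"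

lemma branch_edges_subset: "branch_edges d w i \<subseteq> cube_edges d"
  unfolding branch_edges_def cube_edges_eq
  by (rule dir_edges_mono) (auto simp: branch_vertices_def)

lemma branch_vertices_disjoint:
  "i \<noteq> j \<Longrightarrow> branch_vertices d w i \<inter> branch_vertices d w j = {}"
  by (cases i j rule: linorder_cases) (auto simp: branch_vertices_def)

lemma flip_in_branch: "x \<in> branch_vertices d w i \<Longrightarrow> i < j \<Longrightarrow> j < d \<Longrightarrow> flip x j \<in> branch_vertices d w i"
  by (auto simp: branch_vertices_def cube_vertices_def flip_nth)

lemma branch_edge_vertices:
  assumes "e \<in> branch_edges d w i"
  shows "e \<noteq> {}" "e \<subseteq> branch_vertices d w i"
  using assms flip_in_branch by (auto simp: branch_edges_def dir_edges_def)

lemma branch_edges_disjoint: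
  assumes "i \<noteq> j" shows "branch_edges d w i \<inter> branch_edges d w j = {}"
proof -
  have False if "e \<in> branch_edges d w i" "e \<in> branch_edges d w j" for e
    using branch_edge_vertices[OF that(1)] branch_edge_vertices[OF that(2)]
      branch_vertices_disjoint[OF assms, of d w] by (metis Int_greatest subset_empty)
  then show ?thesis by auto
qed

text \<open>The branch has \<open>d - 1 - i\<close> directions, so by isoperimetry a set of fewer
  than \<open>m\<close> vertices has at least \<open>d - 1 - i - log 2 m \<ge> n\<close> boundary
  edges per vertex, as \<open>cluster_large_prob\<close> demands.\<close>

lemma branch_cluster_prob:
  fixes p r :: real and n m :: nat
  assumes w: "w \<in> cube_vertices d" and i: "i < d" and p: "0 \<le> p" "p \<le> 1"
    and r: "1 \<le> r" "r \<le> real n * p" and m: "real n + log 2 m + Suc i \<le> d"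
  shows "pexp p (branch_edges d w i) (\<lambda>F. of_bool (card (cluster F {flip w i}) < m)) \<le> 1 / r"
proof (rule cluster_large_prob[OF _ _ p r])
  show "finite (branch_edges d w i)"
    using branch_edges_subset finite_cube_edges by (rule finite_subset)
  show "\<exists>x y. e = {x, y}" if "e \<in> branch_edges d w i" for e
    using that branch_edges_subset cube_edges_doubleton by blast
  fix S assume S: "finite S" "flip w i \<in> S" "S \<subseteq> cluster (branch_edges d w i) {flip w i}" "card S < m"
  have "flip w i \<in> branch_vertices d w i"
    using w i by (auto simp: branch_vertices_def cube_vertices_def flip_nth)
  then have sub: "cluster (branch_edges d w i) {flip w i} \<subseteq> branch_vertices d w i"
    by (intro cluster_least) (use branch_edge_vertices(2) in blast)+
  have "card S * (card {i<..<d} - log 2 (card S)) \<le> card (boundary (branch_edges d w i) S)"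
    unfolding branch_edges_def
  proof (rule card_boundary_ge)
    show "S \<subseteq> branch_vertices d w i" using S(3) sub by (rule subset_trans)
  qed (auto simp: branch_vertices_def)
  moreover have "0 < card S" using S by (auto simp: card_gt_0_iff)
  then have "log 2 (card S) \<le> log 2 m" using S(4) by simp
  then have "real n \<le> card {i<..<d} - log 2 (card S)" using m i by simp
  then have "card S * real n \<le> card S * (card {i<..<d} - log 2 (card S))"
    by (intro mult_left_mono) auto
  ultimately have "real (n * card S) \<le> real (card (boundary (branch_edges d w i) S))"
    by (simp only: of_nat_mult mult.commute[of "real n"])
  then show "n * card S \<le> card (boundary (branch_edges d w i) S)"
    by (simp only: of_nat_le_iff)
qed

text \<open>An exponential moment bound. A branch contributes 1/2 if its cluster is large and 1
  otherwise, hence at most \<open>1/2 + 1 / (2 * r)\<close> on average. By independence the product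
  over \<open>n0\<close> branches averages at most the power of this, while it exceeds
  \<open>2 powr - k\<close> if \<open>w\<close> is atypical.\<close>

lemma atypical_prob:
  fixes p r k :: real and n m n0 :: nat
  assumes w: "w \<in> cube_vertices d" and p: "0 \<le> p" "p \<le> 1"
    and r: "1 \<le> r" "r \<le> real n * p" and m: "real n + log 2 m + n0 \<le> d" "1 \<le> m"
  shows "pexp p (cube_edges d) (\<lambda>F. of_bool (w \<in> atypical d m k F)) \<le> 2 powr k * (1/2 + 1 / (2 * r)) ^ n0"
proof -
  define f where "f = (\<lambda>i F. if \<not> card (cluster F {flip w i}) < m then 1/2 else 1 :: real)"
  define E where "E = branch_edges d w"
  have n0: "n0 \<le> d" using m by (smt (verit) of_nat_le_iff of_nat_0_le_iff zero_le_log_cancel_iff of_nat_1)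
  have f: "pexp p (E i) (f i) \<le> 1/2 + 1 / (2 * r)" if "i < n0" for i
  proof -
    have fin: "finite (E i)" unfolding E_def
      using branch_edges_subset finite_cube_edges by (rule finite_subset)
    have "pexp p (E i) (f i) = pexp p (E i) (\<lambda>F. 1/2 + 1/2 * of_bool (card (cluster F {flip w i}) < m))"
      by (intro pexp_cong) (simp add: f_def)
    also have "\<dots> = 1/2 + 1/2 * pexp p (E i) (\<lambda>F. of_bool (card (cluster F {flip w i}) < m))"
      by (simp only: pexp_add pexp_cmult pexp_const[OF fin])
    also have "\<dots> \<le> 1/2 + 1/2 * (1 / r)" unfolding E_def
      using that n0 m by (intro add_left_mono mult_left_mono branch_cluster_prob[OF w _ p r]) auto
    finally show ?thesis by simp
  qed
  have "pexp p (cube_edges d) (\<lambda>F. of_bool (w \<in> atypical d m k F)) \<le>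
      pexp p (cube_edges d) (\<lambda>F. 2 powr k * (\<Prod>i<n0. f i (F \<inter> E i)))"
  proof (intro pexp_mono p)
    fix F assume F: "F \<subseteq> cube_edges d"
    define T where "T = {i. i < n0 \<and> \<not> card (cluster (F \<inter> E i) {flip w i}) < m}"
    have "(\<Prod>i<n0. f i (F \<inter> E i)) = (1/2) ^ card T"
      unfolding f_def T_def by (subst prod_if_one) auto
    also have "\<dots> = 2 powr (- real (card T))"
      unfolding powr_minus by (subst powr_realpow) (simp_all add: power_one_over inverse_eq_divide)
    finally have prod: "(\<Prod>i<n0. f i (F \<inter> E i)) = 2 powr (- real (card T))" .
    \<comment> \<open>A cluster formed inside one branch is only part of the full cluster, so being
      large in the branch suffices.\<close>
    have "T \<subseteq> nbrs_in d w (large d m F)"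
    proof
      fix i assume "i \<in> T"
      then have i: "i < n0" "m \<le> card (cluster (F \<inter> E i) {flip w i})" by (auto simp: T_def)
      have "cluster (F \<inter> E i) {flip w i} \<subseteq> cluster F {flip w i}" by (intro cluster_mono) auto
      moreover have "finite (cluster F {flip w i})"
        using w by (intro finite_subset[OF cluster_subset_cube[OF F] finite_cube_vertices]) simp
      ultimately have "m \<le> card (cluster F {flip w i})" using i by (meson card_mono le_trans)
      then show "i \<in> nbrs_in d w (large d m F)"
        using i n0 w by (auto simp: nbrs_in_def large_def)
    qed
    then have "card T \<le> card (nbrs_in d w (large d m F))" by (intro card_mono) auto
    then have "w \<in> atypical d m k F \<Longrightarrow> 1 \<le> 2 powr (k + - real (card T))"
      by (intro ge_one_powr_ge_zero) (auto simp: atypical_def)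
    then show "of_bool (w \<in> atypical d m k F) \<le> 2 powr k * (\<Prod>i<n0. f i (F \<inter> E i))"
      unfolding prod powr_add by (simp add: of_bool_def)
  qed
  also have "\<dots> = 2 powr k * (\<Prod>i<n0. pexp p (E i) (f i))"
    unfolding pexp_cmult
    by (subst pexp_prod) (use branch_edges_subset branch_edges_disjoint in \<open>auto simp: E_def\<close>)
  also have "(\<Prod>i<n0. pexp p (E i) (f i)) \<le> (\<Prod>i<n0. 1/2 + 1 / (2 * r))"
    using f p by (intro prod_mono) (auto simp: f_def intro!: pexp_nonneg)
  finally show ?thesis by simp
qed

lemma expected_atypical:
  fixes p r k :: real and n m n0 :: nat
  assumes p: "0 \<le> p" "p \<le> 1"
    and r: "1 \<le> r" "r \<le> real n * p" and m: "real n + log 2 m + n0 \<le> d" "1 \<le> m"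
  shows "pexp p (cube_edges d) (\<lambda>F. card (atypical d m k F)) \<le> 2 ^ d * (2 powr k * (1/2 + 1 / (2 * r)) ^ n0)"
proof -
  have "real (card (atypical d m k F)) = (\<Sum>w\<in>cube_vertices d. of_bool (w \<in> atypical d m k F))" for F
    by (simp add: atypical_def of_bool_def sum.If_cases Int_def)
  then have "pexp p (cube_edges d) (\<lambda>F. card (atypical d m k F))
      = (\<Sum>w\<in>cube_vertices d. pexp p (cube_edges d) (\<lambda>F. of_bool (w \<in> atypical d m k F)))"
    by (simp only: pexp_sum)
  also have "\<dots> \<le> (\<Sum>w\<in>cube_vertices d. 2 powr k * (1/2 + 1 / (2 * r)) ^ n0)"
    by (intro sum_mono atypical_prob[where n=n] assms)
  finally show ?thesis by (simp add: card_cube_vertices)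
qed

text \<open>The \<open>d\<close> edges at \<open>x\<close> are independent, so the expectation is
  \<open>(1 + p * (exp 1 - 1)) ^ d\<close>. With \<open>d * p\<close> bounded, this controls the
  total degree of every small vertex set at once.\<close>

lemma expected_exp_degree:
  fixes p :: real
  assumes p: "0 \<le> p" "p \<le> 1"
  shows "pexp p (cube_edges d) (\<lambda>F. \<Sum>x\<in>cube_vertices d. exp (open_degree d F x)) \<le> 2 ^ d * exp (2 * (d * p))"
proof -
  have "pexp p (cube_edges d) (\<lambda>F. exp (open_degree d F x)) \<le> exp (2 * (d * p))" if x: "x \<in> cube_vertices d" for x
  proof -
    define f where "f = (\<lambda>i F. if {x, flip x i} \<in> F then exp 1 else 1 :: real)"
    have inj: "i = j" if "{x, flip x i} = {x, flip x j}" "i < d" "j < d" for i j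
      using that x by (intro flip_inj[of i x j]) (auto simp: cube_vertices_def doubleton_eq_iff)
    have "exp (open_degree d F x) = (\<Prod>i<d. f i (F \<inter> {{x, flip x i}}))" for F
    proof -
      have "(\<Prod>i<d. f i (F \<inter> {{x, flip x i}})) = exp 1 ^ open_degree d F x"
        unfolding f_def open_degree_def by (subst prod_if_one) auto
      then show ?thesis by (simp flip: exp_of_nat_mult)
    qed
    then have "pexp p (cube_edges d) (\<lambda>F. exp (open_degree d F x)) = (\<Prod>i<d. pexp p {{x, flip x i}} (f i))"
      by (simp add: pexp_prod cube_edge_flip x inj)
        (subst pexp_prod, use inj x in \<open>auto simp: cube_edge_flip\<close>)
    also have "\<dots> = (\<Prod>i<d. 1 + p * (exp 1 - 1))"
      by (intro prod.cong) (auto simp: pexp_insert f_def algebra_simps)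
    also have "\<dots> \<le> exp (2 * p) ^ d"
    proof -
      have "1 + p * (exp 1 - 1) \<le> 1 + p * 2" using p exp_le by (intro add_left_mono mult_left_mono) auto
      also have "\<dots> \<le> exp (2 * p)" using exp_ge_add_one_self[of "2 * p"] by (simp add: mult.commute)
      finally show ?thesis using p by (simp add: power_mono)
    qed
    finally show ?thesis by (simp add: mult_ac flip: exp_of_nat_mult)
  qed
  then have "(\<Sum>x\<in>cube_vertices d. pexp p (cube_edges d) (\<lambda>F. exp (open_degree d F x))) \<le> (\<Sum>x\<in>cube_vertices d. exp (2 * (d * p)))"
    by (rule sum_mono)
  then show ?thesis by (simp add: pexp_sum card_cube_vertices)
qed

subsection \<open>Long cycles from separators\<close>

definition restr :: "'a set set \<Rightarrow> 'a set \<Rightarrow> 'a set set" where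
  "restr F X = {e \<in> F. e \<subseteq> X}"

definition nbhd :: "'a set set \<Rightarrow> 'a set \<Rightarrow> 'a set" where
  "nbhd F W = {y. y \<notin> W \<and> (\<exists>x\<in>W. {x, y} \<in> F)}"

abbreviation walk :: "'a set set \<Rightarrow> 'a list \<Rightarrow> bool" where
  "walk F \<equiv> successively (\<lambda>x y. {x, y} \<in> F)"

lemma cluster_restr_subset: "x \<in> Y \<Longrightarrow> cluster (restr F Y) {x} \<subseteq> Y"
  by (rule cluster_least) (auto simp: restr_def)

lemma walk_mono: "walk F xs \<Longrightarrow> F \<subseteq> F' \<Longrightarrow> walk F' xs"
  by (erule successively_mono) auto

lemma is_cycleI:
  assumes "walk F vs" "distinct vs" "3 \<le> length vs" "{last vs, hd vs} \<in> F"
  shows "is_cycle F vs"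
  unfolding is_cycle_def
proof (intro conjI allI impI)
  fix i assume i: "i < length vs"
  show "{vs ! i, vs ! ((i + 1) mod length vs)} \<in> F"
  proof (cases "Suc i = length vs")
    case True
    then have "last vs = vs ! i" "hd vs = vs ! 0" using assms(3)
      by (metis One_nat_def diff_Suc_1 last_conv_nth list.size(3) not_numeral_le_zero)
        (use assms(3) in \<open>auto intro: hd_conv_nth\<close>)
    then show ?thesis using assms(4) True by simp
  next
    case False
    then show ?thesis using assms(1) i by (auto simp: successively_conv_nth)
  qed
qed (use assms in auto)

lemma cluster_path:
  assumes "y \<in> cluster F {x}"
  obtains xs where "xs \<noteq> []" "hd xs = x" "last xs = y" "distinct xs" "walk F xs" "set xs \<subseteq> cluster F {x}"
proof -
  have "(x, y) \<in> (conn F)\<^sup>*" using assms by (simp add: cluster_def)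
  then have "\<exists>xs. xs \<noteq> [] \<and> hd xs = x \<and> last xs = y \<and> distinct xs \<and> walk F xs \<and> set xs \<subseteq> cluster F {x}"
  proof (induction rule: rtrancl_induct)
    case base
    show ?case by (intro exI[of _ "[x]"]) simp
  next
    case (step y z)
    then obtain xs where xs: "xs \<noteq> []" "hd xs = x" "last xs = y" "distinct xs" "walk F xs" "set xs \<subseteq> cluster F {x}"
      by blast
    have yz: "{y, z} \<in> F" using step.hyps(2) by (simp add: conn_def)
    show ?case
    proof (cases "z \<in> set xs")
      case True
      then obtain as bs where "xs = as @ z # bs" by (meson split_list)
      then show ?thesis using xs
        by (intro exI[of _ "as @ [z]"]) (auto simp: successively_append_iff hd_append)
    next
      case False
      have "y \<in> cluster F {x}" using xs(1,3,6) by auto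
      then have "z \<in> cluster F {x}" using yz by (rule cluster_closed)
      then show ?thesis using xs False yz
        by (intro exI[of _ "xs @ [z]"]) (auto simp: successively_append_iff)
    qed
  qed
  then show ?thesis using that by blast
qed

text \<open>Take a union \<open>W\<close> of clusters with the most vertices of \<open>U\<close>
  subject to \<open>card (W \<inter> U) \<le> k\<close>. If it has fewer than \<open>k / 2\<close>,
  adding any further cluster that meets \<open>U\<close> must overshoot \<open>k\<close>, so that
  cluster alone has more than \<open>k / 2\<close> and can be used instead.\<close>

lemma union_of_clusters:
  fixes k :: nat
  assumes "finite Y" "\<And>z. z \<in> Y \<Longrightarrow> card (cluster (restr F Y) {z} \<inter> U) \<le> k" "k \<le> card (Y \<inter> U)"
  shows "\<exists>W\<subseteq>Y. (\<forall>z\<in>W. cluster (restr F Y) {z} \<subseteq> W) \<and> k \<le> 2 * card (W \<inter> U) \<and> card (W \<inter> U) \<le> k"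
proof -
  let ?C = "\<lambda>z. cluster (restr F Y) {z}"
  let ?P = "\<lambda>W. W \<subseteq> Y \<and> (\<forall>z\<in>W. ?C z \<subseteq> W) \<and> card (W \<inter> U) \<le> k"
  have "?P {}" by simp
  moreover have "\<forall>W. ?P W \<longrightarrow> card (W \<inter> U) < Suc k" by auto
  ultimately obtain W where W: "?P W" and max: "\<And>W'. ?P W' \<Longrightarrow> card (W' \<inter> U) \<le> card (W \<inter> U)"
    using ex_has_greatest_nat[of ?P "{}" "\<lambda>W. card (W \<inter> U)" "Suc k"] by blast
  show ?thesis
  proof (cases "k \<le> 2 * card (W \<inter> U)")
    case True
    then show ?thesis using W by blast
  next
    case False
    then have "card (W \<inter> U) < card (Y \<inter> U)" using assms(3) by linarith
    then have "\<not> Y \<inter> U \<subseteq> W \<inter> U" using assms(1) W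
      by (metis card_mono finite_Int finite_subset not_le)
    then obtain z where z: "z \<in> Y" "z \<in> U" "z \<notin> W" by blast
    have CY: "?C z \<subseteq> Y" using z by (intro cluster_restr_subset)
    have Cz: "?C u \<subseteq> ?C z" if "u \<in> ?C z" for u using that by (rule cluster_subset_cluster)
    have disj: "W \<inter> ?C z = {}" using W z(3) cluster_sym by fast
    have fin: "finite (W \<inter> U)" "finite (?C z \<inter> U)"
      using W CY assms(1) by (auto intro: finite_subset)
    have "z \<in> ?C z \<inter> U" using z by simp
    then have pos: "0 < card (?C z \<inter> U)" unfolding card_gt_0_iff using fin by blast
    have card: "card ((W \<union> ?C z) \<inter> U) = card (W \<inter> U) + card (?C z \<inter> U)"
      using fin disj by (subst card_Un_disjoint[symmetric]) (auto simp: Int_Un_distrib2)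
    have "\<not> ?P (W \<union> ?C z)" using max[of "W \<union> ?C z"] card pos by linarith
    moreover have "W \<union> ?C z \<subseteq> Y" "\<forall>u\<in>W \<union> ?C z. ?C u \<subseteq> W \<union> ?C z" using W CY Cz by blast+
    ultimately have "k < card (W \<inter> U) + card (?C z \<inter> U)" using card by linarith
    then have "k \<le> 2 * card (?C z \<inter> U)" using False by linarith
    then show ?thesis using CY Cz assms(2)[OF z(1)] by blast
  qed
qed

text \<open>The alternative of at most one neighbour covers the cases in which no cycle can be
  closed. If no cycle is longer than \<open>t \<ge> 1\<close>, both alternatives bound the
  neighbourhood by \<open>t\<close>.\<close>

definition cyclic_separator :: "'a set set \<Rightarrow> 'a set \<Rightarrow> nat \<Rightarrow> 'a set \<Rightarrow> bool" where
  "cyclic_separator F U k W \<longleftrightarrow> k \<le> 2 * card (W \<inter> U) \<and> card (W \<inter> U) \<le> k \<and>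
     (card (nbhd F W) \<le> 1 \<or> (\<exists>vs. is_cycle F vs \<and> card (nbhd F W) < length vs))"

text \<open>
  This replaces the depth-first search tree: \<open>P\<close> is the current branch, \<open>Y\<close> the part of the
  graph below its last vertex. Descend while some component of \<open>Y\<close> is heavy; then a union of
  light components has all its neighbours on the branch.
\<close>

lemma cyclic_separator_below_path:
  assumes "finite Y" "P \<noteq> []" "distinct P" "walk F P" "Y \<inter> set P = {}" "nbhd F Y \<subseteq> set P"
    "\<And>z. z \<in> Y \<Longrightarrow> \<exists>z'\<in>cluster (restr F Y) {z}. {last P, z'} \<in> F" "k \<le> card (Y \<inter> U)"
  shows "\<exists>W\<subseteq>Y. cyclic_separator F U k W"
  using assms
proof (induction "card Y" arbitrary: Y P rule: less_induct)
  case less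
  show ?case
  proof (cases "\<exists>z\<in>Y. k < card (cluster (restr F Y) {z} \<inter> U)")
    case True
    then obtain z where z: "z \<in> Y" "k < card (cluster (restr F Y) {z} \<inter> U)" by blast
    define C where "C = cluster (restr F Y) {z}"
    obtain z' where z': "z' \<in> C" "{last P, z'} \<in> F" using less.prems(7)[OF z(1)] by (auto simp: C_def)
    have CY: "C \<subseteq> Y" unfolding C_def using z(1) by (rule cluster_restr_subset)
    have closed: "y \<in> C" if "x \<in> C" "{x, y} \<in> F" "y \<in> Y" for x y
    proof -
      have "{x, y} \<in> restr F Y" using that CY by (auto simp: restr_def)
      then show ?thesis using cluster_closed that(1) unfolding C_def by metis
    qed
    \<comment> \<open>Descend: \<open>z'\<close>, an entry point into the heavy component
      \<open>C\<close>, extends the branch, and the rest of \<open>C\<close> is what lies below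
      it.\<close>
    define Y' where "Y' = C - {z'}"
    have "\<exists>W\<subseteq>Y'. cyclic_separator F U k W"
    proof (rule less.hyps)
      have "Y' \<subset> Y" using CY z'(1) by (auto simp: Y'_def)
      then show "card Y' < card Y" using less.prems(1) by (rule psubset_card_mono[rotated])
      show "finite Y'" using less.prems(1) CY by (auto simp: Y'_def intro: finite_subset)
      show "P @ [z'] \<noteq> []" by simp
      show "distinct (P @ [z'])" using less.prems(3,5) z'(1) CY by auto
      show "walk F (P @ [z'])" using less.prems(2,4) z' by (auto simp: successively_append_iff)
      show "Y' \<inter> set (P @ [z']) = {}" using less.prems(5) CY by (auto simp: Y'_def)
      show "nbhd F Y' \<subseteq> set (P @ [z'])"
      proof
        fix y assume "y \<in> nbhd F Y'"
        then obtain x where x: "x \<in> Y'" "{x, y} \<in> F" "y \<notin> Y'" by (auto simp: nbhd_def)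
        show "y \<in> set (P @ [z'])"
        proof (cases "y \<in> Y")
          case True
          then have "y \<in> C" using closed x by (auto simp: Y'_def)
          then show ?thesis using x by (auto simp: Y'_def)
        next
          case False
          then have "y \<in> nbhd F Y" using x CY by (auto simp: nbhd_def Y'_def)
          then show ?thesis using less.prems(6) by auto
        qed
      qed
      \<comment> \<open>A component of \<open>Y'\<close> without a neighbour in \<open>z'\<close>
        would be a whole component of \<open>Y\<close>, that is \<open>C\<close>, which contains
        \<open>z'\<close>.\<close>
      show "\<exists>u'\<in>cluster (restr F Y') {u}. {last (P @ [z']), u'} \<in> F" if u: "u \<in> Y'" for u
      proof (rule ccontr)
        assume "\<not> ?thesis"
        then have no: "{z', u'} \<notin> F" if "u' \<in> cluster (restr F Y') {u}" for u' using that by auto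
        have D: "cluster (restr F Y') {u} \<subseteq> Y'" using u by (rule cluster_restr_subset)
        have "u \<in> cluster (restr F Y) {z}" using u by (simp add: Y'_def C_def)
        then have "C = cluster (restr F Y) {u}" unfolding C_def by (rule cluster_eq[symmetric])
        also have "\<dots> \<subseteq> cluster (restr F Y') {u}"
        proof (rule cluster_least)
          fix x y assume x: "x \<in> cluster (restr F Y') {u}" and xy: "{x, y} \<in> restr F Y"
          then have "y \<in> C" using D by (intro closed[of x y]) (auto simp: restr_def Y'_def)
          moreover have "y \<noteq> z'" using no[OF x] xy by (auto simp: restr_def insert_commute)
          ultimately have "{x, y} \<in> restr F Y'" using x D xy by (auto simp: restr_def Y'_def)
          then show "y \<in> cluster (restr F Y') {u}" using x cluster_closed by metis
        qed simp
        finally show False using z'(1) D by (auto simp: Y'_def)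
      qed
      \<comment> \<open>Dropping \<open>z'\<close> loses at most one vertex of \<open>U\<close>;
        heaviness was defined by a strict inequality for this reason.\<close>
      have "card (C \<inter> U) \<le> card (insert z' (Y' \<inter> U))"
        using less.prems(1) CY by (intro card_mono) (auto simp: Y'_def intro: finite_subset)
      also have "\<dots> \<le> Suc (card (Y' \<inter> U))" by (rule card_insert_le_m1) simp_all
      finally show "k \<le> card (Y' \<inter> U)" using z(2) by (simp add: C_def)
    qed
    moreover have "Y' \<subseteq> Y" using CY by (auto simp: Y'_def)
    ultimately show ?thesis by (meson subset_trans)
  next
    case False
    then have light: "card (cluster (restr F Y) {z} \<inter> U) \<le> k" if "z \<in> Y" for z
      using that by (meson not_le)
    obtain W where W: "W \<subseteq> Y" "\<And>z. z \<in> W \<Longrightarrow> cluster (restr F Y) {z} \<subseteq> W"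
      "k \<le> 2 * card (W \<inter> U)" "card (W \<inter> U) \<le> k"
      using union_of_clusters[OF less.prems(1) light less.prems(8)] by blast
    have NP: "nbhd F W \<subseteq> set P"
    proof
      fix y assume "y \<in> nbhd F W"
      then obtain x where x: "x \<in> W" "{x, y} \<in> F" "y \<notin> W" by (auto simp: nbhd_def)
      have "y \<notin> Y"
      proof
        assume "y \<in> Y"
        then have "{x, y} \<in> restr F Y" using x W(1) by (auto simp: restr_def)
        then have "y \<in> cluster (restr F Y) {x}" using cluster_self cluster_closed by metis
        then show False using W(2)[OF x(1)] x(3) by blast
      qed
      then show "y \<in> set P" using x W(1) less.prems(6) by (auto simp: nbhd_def)
    qed
    \<comment> \<open>The cycle: let \<open>y\<close> be the first vertex of the branch that
      neighbours \<open>W\<close>. Follow the branch from \<open>y\<close> to its end, enter the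
      component of a neighbour \<open>w0\<close> of \<open>y\<close> in \<open>W\<close>, go through
      it to \<open>w0\<close>, and return to \<open>y\<close>. All neighbours of \<open>W\<close>
      lie on the segment starting at \<open>y\<close>, and the detour adds at least one more
      vertex.\<close>
    have "\<exists>vs. is_cycle F vs \<and> card (nbhd F W) < length vs" if c: "\<not> card (nbhd F W) \<le> 1"
    proof -
      have "nbhd F W \<noteq> {}" using c by auto
      then have "\<exists>y\<in>set P. y \<in> nbhd F W" using NP by blast
      then obtain as y bs where P: "P = as @ y # bs" "y \<in> nbhd F W" "\<forall>x\<in>set as. x \<notin> nbhd F W"
        by (elim split_list_first_propE)
      have sub: "nbhd F W \<subseteq> set (y # bs)"
      proof
        fix x assume "x \<in> nbhd F W"
        then have "x \<in> set P" "x \<notin> set as" using NP P(3) by blast+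
        then show "x \<in> set (y # bs)" by (simp add: P(1))
      qed
      have dist: "distinct (y # bs)" using less.prems(3) P(1) by simp
      have cle: "card (nbhd F W) \<le> length (y # bs)"
        using card_mono[OF _ sub] distinct_card[OF dist] by simp
      obtain w0 where w0: "w0 \<in> W" "{w0, y} \<in> F" using P(2) by (auto simp: nbhd_def)
      have "w0 \<in> Y" using w0 W(1) by blast
      then obtain w1 where w1: "w1 \<in> cluster (restr F Y) {w0}" "{last P, w1} \<in> F"
        using less.prems(7)[OF \<open>w0 \<in> Y\<close>] by blast
      have "w0 \<in> cluster (restr F Y) {w1}" using w1(1) by (rule cluster_sym)
      then obtain Q where Q: "Q \<noteq> []" "hd Q = w1" "last Q = w0" "distinct Q" "walk (restr F Y) Q"
        "set Q \<subseteq> cluster (restr F Y) {w1}" by (rule cluster_path)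
      have QY: "set Q \<subseteq> Y"
        using Q(6) cluster_restr_subset[OF \<open>w0 \<in> Y\<close>, of F] cluster_eq[OF w1(1)] by simp
      have "is_cycle F ((y # bs) @ Q)"
      proof (rule is_cycleI)
        have "walk F (y # bs)" using less.prems(4) unfolding P(1) successively_append_iff by blast
        moreover have "walk F Q" using Q(5) by (rule walk_mono) (auto simp: restr_def)
        moreover have "{last (y # bs), hd Q} \<in> F" using w1(2) Q(2) P(1) by simp
        ultimately show "walk F ((y # bs) @ Q)" unfolding successively_append_iff by blast
        show "distinct ((y # bs) @ Q)" using dist Q(4) QY less.prems(5) P(1) by auto
        have "1 \<le> length Q" using Q(1) by (simp add: Suc_leI)
        then show "3 \<le> length ((y # bs) @ Q)" using cle c by simp
        show "{last ((y # bs) @ Q), hd ((y # bs) @ Q)} \<in> F" using Q(1,3) w0(2) by simp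
      qed
      moreover have "card (nbhd F W) < length ((y # bs) @ Q)"
      proof -
        have "0 < length Q" using Q(1) by simp
        then show ?thesis using cle unfolding length_append by linarith
      qed
      ultimately show ?thesis by blast
    qed
    then show ?thesis using W unfolding cyclic_separator_def by blast
  qed
qed

text \<open>Start the descent at a vertex of a heavy component. If there is none, a union of
  components works, and its neighbourhood is empty.\<close>

lemma cyclic_separator_exists:
  assumes "finite V" "\<And>e. e \<in> F \<Longrightarrow> e \<subseteq> V" "k \<le> card (V \<inter> U)"
  shows "\<exists>W\<subseteq>V. cyclic_separator F U k W"
proof (cases "\<exists>z\<in>V. k < card (cluster (restr F V) {z} \<inter> U)")
  case True
  then obtain z where z: "z \<in> V" "k < card (cluster (restr F V) {z} \<inter> U)" by blast
  have RF: "restr F V = F" using assms(2) by (auto simp: restr_def)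
  define C where "C = cluster F {z}"
  have CV: "C \<subseteq> V" using cluster_restr_subset[OF z(1), of F] by (simp add: C_def RF)
  define Y where "Y = C - {z}"
  have finY: "finite Y" using CV assms(1) by (auto simp: Y_def intro: finite_subset)
  have "\<exists>W\<subseteq>Y. cyclic_separator F U k W"
  proof (rule cyclic_separator_below_path)
    show "[z] \<noteq> []" "distinct [z]" "walk F [z]" "Y \<inter> set [z] = {}" by (auto simp: Y_def)
    show "finite Y" by (rule finY)
    show "nbhd F Y \<subseteq> set [z]"
      using cluster_closed[of _ F "{z}"] by (auto simp: nbhd_def Y_def C_def)
    show "\<exists>u'\<in>cluster (restr F Y) {u}. {last [z], u'} \<in> F" if u: "u \<in> Y" for u
    proof (rule ccontr)
      assume "\<not> ?thesis"
      then have no: "{z, u'} \<notin> F" if "u' \<in> cluster (restr F Y) {u}" for u' using that by auto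
      have D: "cluster (restr F Y) {u} \<subseteq> Y" using u by (rule cluster_restr_subset)
      have "u \<in> cluster F {z}" using u by (simp add: Y_def C_def)
      then have "z \<in> cluster F {u}" by (rule cluster_sym)
      also have "\<dots> \<subseteq> cluster (restr F Y) {u}"
      proof (rule cluster_least)
        fix x y assume x: "x \<in> cluster (restr F Y) {u}" and xy: "{x, y} \<in> F"
        then have "y \<in> C" using D cluster_closed[of x F "{z}" y] by (auto simp: Y_def C_def)
        moreover have "y \<noteq> z" using no[OF x] xy by (auto simp: insert_commute)
        ultimately have "{x, y} \<in> restr F Y" using x D xy by (auto simp: restr_def Y_def)
        then show "y \<in> cluster (restr F Y) {u}" using x cluster_closed by metis
      qed simp
      finally show False using D by (auto simp: Y_def)
    qed
    have "card (C \<inter> U) \<le> card (insert z (Y \<inter> U))"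
      using finY by (intro card_mono) (auto simp: Y_def)
    also have "\<dots> \<le> Suc (card (Y \<inter> U))" by (rule card_insert_le_m1) simp_all
    finally show "k \<le> card (Y \<inter> U)" using z(2) by (simp add: C_def RF)
  qed
  moreover have "Y \<subseteq> V" using CV by (auto simp: Y_def)
  ultimately show ?thesis by (meson subset_trans)
next
  case False
  then have light: "card (cluster (restr F V) {z} \<inter> U) \<le> k" if "z \<in> V" for z
    using that by (meson not_le)
  obtain W where W: "W \<subseteq> V" "\<And>z. z \<in> W \<Longrightarrow> cluster (restr F V) {z} \<subseteq> W"
    "k \<le> 2 * card (W \<inter> U)" "card (W \<inter> U) \<le> k"
    using union_of_clusters[OF assms(1) light assms(3)] by blast
  have "nbhd F W = {}"
  proof -
    have "y \<in> W" if "x \<in> W" "{x, y} \<in> F" for x y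
    proof -
      have "{x, y} \<in> restr F V" using assms(2) that by (auto simp: restr_def)
      then have "y \<in> cluster (restr F V) {x}" using cluster_self cluster_closed by metis
      then show ?thesis using W(2)[OF that(1)] by blast
    qed
    then show ?thesis by (auto simp: nbhd_def)
  qed
  then show ?thesis using W unfolding cyclic_separator_def by (intro exI[of _ W]) simp
qed

subsection \<open>Sprinkling between two sets\<close>

lemma pexp_nonempty:
  assumes "finite H" shows "pexp p H (\<lambda>G. of_bool (G \<noteq> {})) = 1 - (1 - p) ^ card H"
  using assms
proof (induction H rule: finite_induct)
  case (insert e H)
  have "pexp p (insert e H) (\<lambda>G. of_bool (G \<noteq> {})) = p + (1 - p) * (1 - (1 - p) ^ card H)"
    using insert by (simp add: pexp_insert pexp_const)
  also have "\<dots> = 1 - (1 - p) ^ card (insert e H)"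
    using insert by (simp add: algebra_simps)
  finally show ?case .
qed simp

lemma pexp_union_bound:
  fixes b :: real
  assumes "0 \<le> p" "p \<le> 1" "finite I" "\<And>i. i \<in> I \<Longrightarrow> pexp p E (\<lambda>F. of_bool (P i F)) \<le> b"
  shows "pexp p E (\<lambda>F. of_bool (\<exists>i\<in>I. P i F)) \<le> card I * b"
proof -
  have "pexp p E (\<lambda>F. of_bool (\<exists>i\<in>I. P i F)) \<le> pexp p E (\<lambda>F. \<Sum>i\<in>I. of_bool (P i F))"
  proof (intro pexp_mono assms(1,2))
    fix F
    show "of_bool (\<exists>i\<in>I. P i F) \<le> (\<Sum>i\<in>I. of_bool (P i F) :: real)"
    proof (cases "\<exists>i\<in>I. P i F")
      case True
      then obtain i where i: "i \<in> I" "P i F" by blast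
      have "of_bool (P i F) \<le> (\<Sum>i\<in>I. of_bool (P i F) :: real)"
        using i(1) assms(3) by (intro member_le_sum) auto
      then show ?thesis using True i by simp
    qed (simp add: sum_nonneg)
  qed
  also have "\<dots> = (\<Sum>i\<in>I. pexp p E (\<lambda>F. of_bool (P i F)))" by (rule pexp_sum)
  also have "\<dots> \<le> (\<Sum>i\<in>I. b)" using assms by (intro sum_mono)
  finally show ?thesis by simp
qed

text \<open>For at most half of the cube, \<open>log 2 (card S) \<le> d - 1\<close> leaves at least
  one boundary edge per vertex. Otherwise pass to the complement, all of whose boundary edges are
  boundary edges of \<open>S\<close>.\<close>

lemma cube_isoperimetry:
  assumes "S \<subseteq> cube_vertices d"
  shows "min (card S) (card (cube_vertices d - S)) \<le> card (boundary (cube_edges d) S)"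
proof -
  have half: "card S \<le> card (boundary (cube_edges d) S)"
    if "S \<subseteq> cube_vertices d" "2 * card S \<le> 2 ^ d" for S
  proof (cases "card S = 0")
    case False
    have "real (2 * card S) \<le> real (2 ^ d)" using that(2) by (simp only: of_nat_le_iff)
    then have "log 2 (2 * real (card S)) \<le> log 2 (2 ^ d)"
      using False by (subst log_le_cancel_iff) auto
    also have "log 2 (2 * real (card S)) = 1 + log 2 (card S)" using False by (subst log_mult) auto
    finally have "1 \<le> real d - log 2 (card S)" by simp
    then have "real (card S) * 1 \<le> real (card S) * (real d - log 2 (card S))"
      by (intro mult_left_mono) auto
    also have "\<dots> \<le> card (boundary (cube_edges d) S)"
      using card_boundary_ge[OF that(1), of d "{..<d}"] by (simp add: cube_edges_eq)
    finally show ?thesis by simp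
  qed simp
  have sum: "card S + card (cube_vertices d - S) = 2 ^ d"
    using assms card_cube_vertices[of d] by (metis card_Diff_subset card_mono finite_cube_vertices
        finite_subset le_add_diff_inverse)
  show ?thesis
  proof (cases "2 * card S \<le> 2 ^ d")
    case True
    then show ?thesis using half[OF assms] by simp
  next
    case False
    have "boundary (cube_edges d) (cube_vertices d - S) \<subseteq> boundary (cube_edges d) S"
    proof
      fix e assume "e \<in> boundary (cube_edges d) (cube_vertices d - S)"
      then obtain x y where e: "e \<in> cube_edges d" "e = {x, y}" "x \<notin> S" "y \<notin> cube_vertices d - S"
        by (auto simp: boundary_def)
      then have "y \<in> cube_vertices d" using cube_edgesD(1)[of y x d] by (simp add: insert_commute)
      then have "y \<in> S" using e by blast
      then show "e \<in> boundary (cube_edges d) S" using e unfolding boundary_def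
        by (auto simp: insert_commute)
    qed
    then have "card (boundary (cube_edges d) (cube_vertices d - S)) \<le> card (boundary (cube_edges d) S)"
      by (intro card_mono) (auto simp: boundary_def)
    moreover have "card (cube_vertices d - S) \<le> card (boundary (cube_edges d) (cube_vertices d - S))"
      using False sum by (intro half) auto
    ultimately show ?thesis by simp
  qed
qed

text \<open>Double counting by direction: each flip is an involution of the cube, so every direction
  contributes \<open>card Z\<close>.\<close>

lemma sum_card_nbrs_in:
  assumes "Z \<subseteq> cube_vertices d"
  shows "(\<Sum>w\<in>cube_vertices d. card (nbrs_in d w Z)) = d * card Z"
proof -
  have "card {w \<in> cube_vertices d. flip w i \<in> Z} = card Z" if "i < d" for i
  proof (rule bij_betw_same_card[of "\<lambda>w. flip w i"])
    show "bij_betw (\<lambda>w. flip w i) {w \<in> cube_vertices d. flip w i \<in> Z} Z"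
      by (rule bij_betwI[of _ _ _ "\<lambda>w. flip w i"]) (use assms in auto)
  qed
  moreover have "(\<Sum>w\<in>cube_vertices d. card (nbrs_in d w Z)) = (\<Sum>i<d. card {w \<in> cube_vertices d. flip w i \<in> Z})"
  proof -
    have "card (nbrs_in d w Z) = (\<Sum>i<d. of_bool (flip w i \<in> Z))" for w
      by (simp add: nbrs_in_def of_bool_def sum.If_cases Int_def)
    then have "(\<Sum>w\<in>cube_vertices d. card (nbrs_in d w Z)) = (\<Sum>i<d. \<Sum>w\<in>cube_vertices d. of_bool (flip w i \<in> Z))"
      using sum.swap[of "\<lambda>w i. of_bool (flip w i \<in> Z) :: nat" "{..<d}" "cube_vertices d"] by simp
    also have "\<dots> = (\<Sum>i<d. card {w \<in> cube_vertices d. flip w i \<in> Z})"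
      by (simp add: of_bool_def sum.If_cases Int_def)
    finally show ?thesis .
  qed
  ultimately show ?thesis by simp
qed

text \<open>\<open>P\<close> is viewed as a bipartite graph. Every pair of \<open>P\<close> shares
  its first or its second component with a pair of a maximum matching \<open>M\<close>, and each
  pair of \<open>M\<close> accounts for at most \<open>2 * D\<close> of them.\<close>

lemma exists_matching:
  assumes "finite P" "\<And>w. card (P `` {w}) \<le> D" "\<And>x. card (P\<inverse> `` {x}) \<le> D"
  obtains M where "M \<subseteq> P" "inj_on fst M" "inj_on snd M" "card P \<le> 2 * D * card M"
proof -
  let ?Q = "\<lambda>M. M \<subseteq> P \<and> inj_on fst M \<and> inj_on snd M"
  have "?Q {}" by simp
  moreover have "\<forall>M. ?Q M \<longrightarrow> card M < Suc (card P)"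
    using assms(1) by (auto simp: less_Suc_eq_le intro: card_mono)
  ultimately obtain M where M: "?Q M" and max: "\<And>M'. ?Q M' \<Longrightarrow> card M' \<le> card M"
    using ex_has_greatest_nat[of ?Q "{}" card "Suc (card P)"] by blast
  have finM: "finite M" using M assms(1) finite_subset by blast
  let ?N = "\<lambda>e. {fst e} \<times> P `` {fst e} \<union> P\<inverse> `` {snd e} \<times> {snd e}"
  have "P \<subseteq> (\<Union>e\<in>M. ?N e)"
  proof (rule ccontr)
    assume "\<not> ?thesis"
    then obtain w x where wx: "(w, x) \<in> P" "(w, x) \<notin> (\<Union>e\<in>M. ?N e)" by auto
    then have no: "w \<notin> fst ` M" "x \<notin> snd ` M" by auto
    then have "?Q (insert (w, x) M)" using M wx(1) by (auto simp: inj_on_insert)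
    then have "card (insert (w, x) M) \<le> card M" by (rule max)
    moreover have "(w, x) \<notin> M" using no by force
    ultimately show False using finM by simp
  qed
  moreover have finP: "finite (P `` {w})" "finite (P\<inverse> `` {x})" for w x
    using assms(1) by (auto intro: finite_Image)
  ultimately have "card P \<le> card (\<Union>e\<in>M. ?N e)" using finM by (intro card_mono) auto
  also have "\<dots> \<le> (\<Sum>e\<in>M. card (?N e))" by (rule card_UN_le[OF finM])
  also have "\<dots> \<le> (\<Sum>e\<in>M. 2 * D)"
  proof (rule sum_mono)
    fix e
    have "card (?N e) \<le> card ({fst e} \<times> P `` {fst e}) + card (P\<inverse> `` {snd e} \<times> {snd e})"
      by (rule card_Un_le)
    also have "\<dots> \<le> D + D" using assms by (intro add_mono) (simp_all add: card_cartesian_product)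
    finally show "card (?N e) \<le> 2 * D" by simp
  qed
  finally have "card P \<le> 2 * D * card M" by (simp add: mult_ac)
  then show ?thesis using that M by blast
qed

section \<open>Short connections between two vertex sets\<close>

definition hooked :: "'a set set \<Rightarrow> 'a set \<Rightarrow> 'a \<Rightarrow> bool" where
  "hooked F A w \<longleftrightarrow> w \<in> A \<or> (\<exists>a\<in>A. {w, a} \<in> F)"

text \<open>A connection from \<open>A\<close> to \<open>B\<close> with at most three edges, whose
  middle edge \<open>{w, x}\<close> avoids \<open>Y\<close>.\<close>

definition linked :: "'a set set \<Rightarrow> 'a set \<Rightarrow> 'a set \<Rightarrow> 'a set \<Rightarrow> bool" where
  "linked F Y A B \<longleftrightarrow> (\<exists>w x. w \<notin> Y \<and> x \<notin> Y \<and> {w, x} \<in> F \<and> hooked F A w \<and> hooked F B x)"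

text \<open>A connection starting in \<open>A\<close> can leave \<open>W\<close> only through
  \<open>nbhd F W\<close>, which \<open>w\<close>, \<open>x\<close> and all of \<open>B\<close>
  avoid.\<close>

lemma not_linked_nbhd:
  assumes "A \<subseteq> W" "B \<inter> W = {}" "B \<inter> nbhd F W = {}" "F' \<subseteq> F"
  shows "\<not> linked F' (nbhd F W) A B"
proof
  assume "linked F' (nbhd F W) A B"
  then obtain w x where wx: "w \<notin> nbhd F W" "x \<notin> nbhd F W" "{w, x} \<in> F" "hooked F A w" "hooked F B x"
    using assms(4) by (fastforce simp: linked_def hooked_def)
  have step: "v \<in> W" if "u \<in> W" "{u, v} \<in> F" "v \<notin> nbhd F W" for u v
    using that by (auto simp: nbhd_def)
  have "w \<in> W" using wx(1,4) assms(1) step[of _ w] by (auto simp: hooked_def insert_commute)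
  then have x: "x \<in> W" using wx step by blast
  then obtain b where "b \<in> B" "{x, b} \<in> F" using wx(5) assms(2) by (auto simp: hooked_def)
  then show False using step[OF x] assms by blast
qed

text \<open>For \<open>w \<in> A\<close> nothing has to be revealed and the set is empty. Every hook
  therefore has exactly one endpoint outside \<open>A\<close>, which makes the hooks of different
  vertices disjoint.\<close>

definition hooks :: "nat \<Rightarrow> bool list set \<Rightarrow> bool list \<Rightarrow> bool list set set" where
  "hooks d A w = (if w \<in> A then {} else {{w, a} | a. a \<in> A \<and> {w, a} \<in> cube_edges d})"

lemma hooks_subset: "hooks d A w \<subseteq> cube_edges d"
  by (auto simp: hooks_def)

lemma finite_hooks [simp]: "finite (hooks d A w)"
  using hooks_subset finite_cube_edges by (rule finite_subset)

lemma hooked_iff: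
  "F \<subseteq> cube_edges d \<Longrightarrow> hooked F A w \<longleftrightarrow> w \<in> A \<or> F \<inter> hooks d A w \<noteq> {}"
  by (auto simp: hooked_def hooks_def)

lemma hooked_prob:
  assumes "0 \<le> p" "p \<le> 1" "w \<in> cube_vertices d" "w \<in> A \<or> h \<le> card (nbrs_in d w A)"
  shows "1 - (1 - p) ^ h \<le> pexp p (hooks d A w) (\<lambda>G. of_bool (w \<in> A \<or> G \<noteq> {}))"
proof (cases "w \<in> A")
  case True
  then show ?thesis using assms by (simp add: pexp_const)
next
  case False
  have "inj_on (\<lambda>i. {w, flip w i}) (nbrs_in d w A)"
    using assms(3) by (auto simp: inj_on_def nbrs_in_def doubleton_eq_iff cube_vertices_def intro: flip_inj[of _ w])
  moreover have "(\<lambda>i. {w, flip w i}) ` nbrs_in d w A \<subseteq> hooks d A w"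
    using False assms(3) by (auto simp: nbrs_in_def hooks_def cube_edge_flip)
  ultimately have "card (nbrs_in d w A) \<le> card (hooks d A w)"
    by (rule card_inj_on_le) simp
  then have "h \<le> card (hooks d A w)" using assms(4) False by simp
  then have "(1 - p) ^ card (hooks d A w) \<le> (1 - p) ^ h"
    using assms by (intro power_decreasing) auto
  then show ?thesis using False by (simp add: pexp_nonempty)
qed

lemma card_cube_neighbours: "card {y. {x, y} \<in> cube_edges d} \<le> d"
proof -
  have "{y. {x, y} \<in> cube_edges d} \<subseteq> flip x ` {..<d}" using cube_edgesD(2) by blast
  then have "card {y. {x, y} \<in> cube_edges d} \<le> card (flip x ` {..<d})" by (intro card_mono) auto
  also have "\<dots> \<le> d" using card_image_le[of "{..<d}" "flip x"] by simp
  finally show ?thesis .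
qed

text \<open>Many disjoint candidate edges, each with an independent chance of completing a
  connection. Isoperimetry gives \<open>s\<close> boundary edges of \<open>A'\<close>, at most
  \<open>s / 2\<close> of them meet \<open>X\<close>, and the others contain a matching of size
  \<open>s / (4 * d)\<close>. A matching edge and the hooks at both of its ends succeed with
  probability at least \<open>p * c\<^sup>2\<close>.\<close>

lemma linked_prob:
  fixes p s c :: real
  assumes p: "0 \<le> p" "p \<le> 1" and d: "0 < d"
    and sub: "A \<subseteq> cube_vertices d" "B \<subseteq> cube_vertices d" "X \<subseteq> cube_vertices d"
    and disj: "A \<inter> B = {}" "X \<inter> (A \<union> B) = {}" "Y \<inter> (A \<union> B) = {}"
    and YX: "Y \<subseteq> X"
    and nbrs: "\<And>w. w \<in> cube_vertices d - A - B - X \<Longrightarrow> h \<le> card (nbrs_in d w A) \<or> h \<le> card (nbrs_in d w B)"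
    and s: "s \<le> card A" "s \<le> card B" "2 * (d * card X) \<le> s"
    and c: "0 \<le> c" "c \<le> 1 - (1 - p) ^ h"
  shows "pexp p (cube_edges d) (\<lambda>F. of_bool (\<not> linked F Y A B)) \<le> exp (- (p * c\<^sup>2 * s / (4 * d)))"
proof -
  let ?V = "cube_vertices d" and ?E = "cube_edges d"
  \<comment> \<open>The cube is divided into \<open>A'\<close>, \<open>B'\<close> and
    \<open>X\<close>: vertices of \<open>A'\<close> lie in \<open>A\<close> or have \<open>h\<close>
    neighbours there, and by \<open>nbrs\<close> the same holds for \<open>B'\<close> and
    \<open>B\<close>.\<close>
  define A' where "A' = A \<union> {w \<in> ?V - A - B - X. h \<le> card (nbrs_in d w A)}"
  define B' where "B' = ?V - A' - X"
  have A': "A' \<subseteq> ?V" "A \<subseteq> A'" "A' \<inter> B = {}" using sub disj by (auto simp: A'_def)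
  have B': "B' \<subseteq> ?V" "B \<subseteq> B'" "B' \<inter> A = {}" "A' \<inter> B' = {}" using sub disj by (auto simp: A'_def B'_def)
  have hA: "w \<in> A \<or> h \<le> card (nbrs_in d w A)" if "w \<in> A'" for w using that by (auto simp: A'_def)
  have hB: "w \<in> B \<or> h \<le> card (nbrs_in d w B)" if "w \<in> B'" for w
    using that nbrs[of w] by (auto simp: A'_def B'_def)
  have notY: "w \<notin> Y" if "w \<in> A' \<union> B'" for w using that YX disj(3) by (auto simp: A'_def B'_def)
  define P where "P = {(w, x). w \<in> A' \<and> x \<in> B' \<and> {w, x} \<in> ?E}"
  have "P \<subseteq> ?V \<times> ?V" using A' B' by (auto simp: P_def)
  then have finP: "finite P" by (rule finite_subset) simp
  have cardP: "s / 2 \<le> card P"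
  proof -
    have fin: "finite A'" "finite B'" "finite X" "finite B" "finite (?V - A')"
      using A' B' sub finite_cube_vertices finite_subset by blast+
    have "s \<le> min (card A') (card (?V - A'))"
    proof -
      have "card A \<le> card A'" using A' fin by (intro card_mono) auto
      moreover have "card B \<le> card (?V - A')" using A' sub fin by (intro card_mono) auto
      ultimately show ?thesis using s by simp
    qed
    also have "\<dots> \<le> card (boundary ?E A')" using cube_isoperimetry[OF A'(1)] by simp
    also have "\<dots> \<le> card ((\<lambda>(w, x). {w, x}) ` P) + card ((\<lambda>(x, i). {x, flip x i}) ` (X \<times> {..<d}))"
    proof -
      have "boundary ?E A' \<subseteq> (\<lambda>(w, x). {w, x}) ` P \<union> (\<lambda>(x, i). {x, flip x i}) ` (X \<times> {..<d})"
      proof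
        fix e assume "e \<in> boundary ?E A'"
        then obtain x y where e: "e = {x, y}" "{x, y} \<in> ?E" "x \<in> A'" "y \<notin> A'" by (auto simp: boundary_def)
        then have yx: "{y, x} \<in> ?E" by (simp add: insert_commute)
        then have "y \<in> ?V" by (rule cube_edgesD)
        show "e \<in> (\<lambda>(w, x). {w, x}) ` P \<union> (\<lambda>(x, i). {x, flip x i}) ` (X \<times> {..<d})"
        proof (cases "y \<in> X")
          case True
          obtain i where "i < d" "x = flip y i" using cube_edgesD(2)[OF yx] by blast
          then have "e = (\<lambda>(x, i). {x, flip x i}) (y, i)" "(y, i) \<in> X \<times> {..<d}"
            using True e(1) by (auto simp: insert_commute)
          then show ?thesis by blast
        next
          case False
          then have "(x, y) \<in> P" using e \<open>y \<in> ?V\<close> by (auto simp: P_def B'_def)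
          then show ?thesis using e(1) by force
        qed
      qed
      then have "card (boundary ?E A') \<le> card ((\<lambda>(w, x). {w, x}) ` P \<union> (\<lambda>(x, i). {x, flip x i}) ` (X \<times> {..<d}))"
        using finP fin by (intro card_mono) auto
      also have "\<dots> \<le> card ((\<lambda>(w, x). {w, x}) ` P) + card ((\<lambda>(x, i). {x, flip x i}) ` (X \<times> {..<d}))"
        by (rule card_Un_le)
      finally show ?thesis by simp
    qed
    also have "\<dots> \<le> card P + card X * d"
    proof -
      have "card ((\<lambda>(w, x). {w, x}) ` P) \<le> card P" using finP by (rule card_image_le)
      moreover have "card ((\<lambda>(x, i). {x, flip x i}) ` (X \<times> {..<d})) \<le> card (X \<times> {..<d})"
        using fin by (intro card_image_le) simp
      ultimately have "card ((\<lambda>(w, x). {w, x}) ` P) + card ((\<lambda>(x, i). {x, flip x i}) ` (X \<times> {..<d}))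
          \<le> card P + card X * d" by (simp add: card_cartesian_product)
      then show ?thesis unfolding of_nat_add[symmetric] of_nat_mult[symmetric] of_nat_le_iff .
    qed
    finally show ?thesis using s(3) by (simp add: mult.commute)
  qed
  have "card (P `` {w}) \<le> d" "card (P\<inverse> `` {w}) \<le> d" for w
  proof -
    have "{y. {w, y} \<in> ?E} \<subseteq> flip w ` {..<d}" using cube_edgesD(2) by blast
    then have fin: "finite {y. {w, y} \<in> ?E}" by (rule finite_subset) simp
    have "card (P `` {w}) \<le> card {y. {w, y} \<in> ?E}" "card (P\<inverse> `` {w}) \<le> card {y. {w, y} \<in> ?E}"
      using fin by (auto intro!: card_mono simp: P_def insert_commute)
    then show "card (P `` {w}) \<le> d" "card (P\<inverse> `` {w}) \<le> d" using card_cube_neighbours[of w d] by linarith+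
  qed
  then obtain M where M: "M \<subseteq> P" "inj_on fst M" "inj_on snd M" "card P \<le> 2 * d * card M"
    using exists_matching[OF finP] by blast
  have finM: "finite M" using M(1) finP by (rule finite_subset)
  have cardM: "s / (4 * d) \<le> card M"
  proof -
    have "real (card P) \<le> 2 * d * card M" using M(4) by (metis of_nat_le_iff of_nat_mult of_nat_numeral)
    then show ?thesis using cardP d by (simp add: field_simps)
  qed
  \<comment> \<open>\<open>L e\<close> is the set of edges that decide whether the candidate
    \<open>e\<close> succeeds, and \<open>g e\<close> is the indicator of success.\<close>
  define L where "L = (\<lambda>(w, x). {{w, x}} \<union> (hooks d A w \<union> hooks d B x))"
  define g where "g = (\<lambda>(w, x) G. of_bool ({w, x} \<in> G) * (of_bool (w \<in> A \<or> G \<inter> hooks d A w \<noteq> {}) *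
      of_bool (x \<in> B \<or> G \<inter> hooks d B x \<noteq> {})) :: real)"
  have LE: "L e \<subseteq> ?E" if "e \<in> M" for e
    using that M(1) hooks_subset by (fastforce simp: L_def P_def)
  \<comment> \<open>A hook at \<open>w\<close> stays inside \<open>A'\<close>, a hook at
    \<open>x\<close> inside \<open>B'\<close>, and the candidate edges run between the two. Within
    its kind, each edge determines the matched vertex to which it belongs.\<close>
  have disjL: "L e \<inter> L e' = {}" if "e \<in> M" "e' \<in> M" "e \<noteq> e'" for e e'
  proof -
    obtain w x w' x' where e: "e = (w, x)" "e' = (w', x')" by (meson surj_pair)
    have "w \<noteq> w'" "x \<noteq> x'" using that M(2,3) e by (force simp: inj_on_def)+
    moreover have "w \<in> A'" "w' \<in> A'" "x \<in> B'" "x' \<in> B'" using that M(1) e by (auto simp: P_def)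
    ultimately show ?thesis using B'(3,4) A'(3) disj(1)
      by (auto simp: e L_def hooks_def doubleton_eq_iff split: if_splits)
  qed
  have g: "p * c\<^sup>2 \<le> pexp p (L e) (g e)" if "e \<in> M" for e
  proof -
    obtain w x where e: "e = (w, x)" by (meson surj_pair)
    have wx: "w \<in> A'" "x \<in> B'" "{w, x} \<in> ?E" using that M(1) e by (auto simp: P_def)
    let ?a = "\<lambda>G. of_bool (w \<in> A \<or> G \<noteq> {}) :: real" and ?b = "\<lambda>G. of_bool (x \<in> B \<or> G \<noteq> {}) :: real"
    have d1: "{{w, x}} \<inter> (hooks d A w \<union> hooks d B x) = {}"
      using wx B'(3,4) A'(3) by (auto simp: hooks_def doubleton_eq_iff split: if_splits)
    have d2: "hooks d A w \<inter> hooks d B x = {}"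
      using wx B'(3,4) A'(3) disj(1) by (auto simp: hooks_def doubleton_eq_iff split: if_splits)
    define f where "f = (\<lambda>G. of_bool ({w, x} \<in> G) :: real)"
    define f' where "f' = (\<lambda>G. ?a (G \<inter> hooks d A w) * ?b (G \<inter> hooks d B x))"
    have "pexp p (L e) (g e) = pexp p ({{w, x}} \<union> (hooks d A w \<union> hooks d B x))
       (\<lambda>G. f (G \<inter> {{w, x}}) * f' (G \<inter> (hooks d A w \<union> hooks d B x)))"
      unfolding e L_def prod.case
      by (intro pexp_cong) (simp add: g_def f_def f'_def Int_assoc Int_absorb1 Int_absorb2)
    also have "\<dots> = pexp p {{w, x}} f * pexp p (hooks d A w \<union> hooks d B x) f'"
      by (rule pexp_indep[OF _ _ d1]) auto
    also have "pexp p {{w, x}} f = p" by (simp add: pexp_insert f_def)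
    also have "pexp p (hooks d A w \<union> hooks d B x) f' = pexp p (hooks d A w) ?a * pexp p (hooks d B x) ?b"
      unfolding f'_def by (rule pexp_indep[OF _ _ d2]) auto
    finally have eq: "pexp p (L e) (g e) = p * (pexp p (hooks d A w) ?a * pexp p (hooks d B x) ?b)" .
    have "p * (c * c) \<le> p * (pexp p (hooks d A w) ?a * pexp p (hooks d B x) ?b)"
    proof -
      have "c \<le> pexp p (hooks d A w) ?a"
        using hooked_prob[OF p _ hA[OF wx(1)]] wx A' c(2) by auto
      moreover have "c \<le> pexp p (hooks d B x) ?b"
        using hooked_prob[OF p _ hB[OF wx(2)]] wx B' c(2) by auto
      ultimately have "c * c \<le> pexp p (hooks d A w) ?a * pexp p (hooks d B x) ?b"
        using c(1) by (intro mult_mono') simp_all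
      then show ?thesis using p(1) by (rule mult_left_mono)
    qed
    then show ?thesis unfolding eq power2_eq_square .
  qed
  have "pexp p ?E (\<lambda>F. of_bool (\<not> linked F Y A B)) \<le> pexp p ?E (\<lambda>F. \<Prod>e\<in>M. 1 - g e (F \<inter> L e))"
  proof (intro pexp_mono p)
    fix F assume F: "F \<subseteq> ?E"
    show "of_bool (\<not> linked F Y A B) \<le> (\<Prod>e\<in>M. 1 - g e (F \<inter> L e))"
    proof (cases "linked F Y A B")
      case True
      have "0 \<le> 1 - g e (F \<inter> L e)" for e by (cases e) (auto simp: g_def)
      then show ?thesis using True by (simp add: prod_nonneg)
    next
      case False
      have "g e (F \<inter> L e) = 0" if e: "e \<in> M" for e
      proof -
        obtain w x where wx: "e = (w, x)" by (meson surj_pair)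
        have AB: "w \<notin> Y" "x \<notin> Y" using e M(1) notY by (auto simp: wx P_def)
        have i: "F \<inter> L e \<inter> hooks d A w = F \<inter> hooks d A w" "F \<inter> L e \<inter> hooks d B x = F \<inter> hooks d B x"
          by (auto simp: L_def wx)
        show ?thesis
        proof (rule ccontr)
          assume "g e (F \<inter> L e) \<noteq> 0"
          then have "{w, x} \<in> F" "w \<in> A \<or> F \<inter> hooks d A w \<noteq> {}" "x \<in> B \<or> F \<inter> hooks d B x \<noteq> {}"
            using i unfolding g_def wx by (auto split: if_splits)
          then have "linked F Y A B" unfolding linked_def hooked_iff[OF F] using AB by blast
          then show False using False by simp
        qed
      qed
      then show ?thesis using False by simp
    qed
  qed
  also have "\<dots> = (\<Prod>e\<in>M. pexp p (L e) (\<lambda>G. 1 - g e G))"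
    using LE disjL by (intro pexp_prod[OF finM]) auto
  also have "\<dots> \<le> (\<Prod>e\<in>M. 1 - p * c\<^sup>2)"
  proof (rule prod_mono)
    fix e assume e: "e \<in> M"
    have fin: "finite (L e)" using LE[OF e] finite_cube_edges by (rule finite_subset)
    have "0 \<le> pexp p (L e) (\<lambda>G. 1 - g e G)"
      using p by (intro pexp_nonneg) (auto simp: g_def split: prod.split)
    then show "0 \<le> pexp p (L e) (\<lambda>G. 1 - g e G) \<and> pexp p (L e) (\<lambda>G. 1 - g e G) \<le> 1 - p * c\<^sup>2"
      using g[OF e] by (simp add: pexp_diff pexp_const[OF fin])
  qed
  also have "\<dots> = (1 - p * c\<^sup>2) ^ card M" by simp
  also have "\<dots> \<le> exp (- (p * c\<^sup>2)) ^ card M"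
  proof (rule power_mono)
    show "1 - p * c\<^sup>2 \<le> exp (- (p * c\<^sup>2))" using exp_ge_add_one_self[of "- (p * c\<^sup>2)"] by simp
    have "c \<le> 1" using c(2) p by (smt (verit) zero_le_power)
    then have "p * c\<^sup>2 \<le> 1" using p c(1) by (intro mult_le_one power_le_one) auto
    then show "0 \<le> 1 - p * c\<^sup>2" by simp
  qed
  also have "\<dots> = exp (- (p * c\<^sup>2 * card M))" by (simp flip: exp_of_nat_mult)
  also have "\<dots> \<le> exp (- (p * c\<^sup>2 * s / (4 * d)))"
  proof -
    have "p * c\<^sup>2 * (s / (4 * d)) \<le> p * c\<^sup>2 * card M"
      using cardM p by (intro mult_left_mono) auto
    then show ?thesis by simp
  qed
  finally show ?thesis by simp
qed

subsection \<open>The union bound over separators\<close>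

text \<open>A set of size at most \<open>t + 1\<close> arises from one of size at most
  \<open>t\<close> by adding one element or none, a choice among \<open>card V + 1\<close>
  options.\<close>

lemma card_small_subsets:
  assumes "finite V"
  shows "card {Y. Y \<subseteq> V \<and> card Y \<le> t} \<le> (card V + 1) ^ t"
proof (induction t)
  case 0
  have "{Y. Y \<subseteq> V \<and> card Y \<le> 0} = {{}}"
    using assms finite_subset by fastforce
  then show ?case by simp
next
  case (Suc t)
  let ?S = "\<lambda>t. {Y. Y \<subseteq> V \<and> card Y \<le> t}"
  have fin: "finite (?S t)" for t using assms by simp
  have "?S (Suc t) \<subseteq> (\<lambda>(Y, o'). Y \<union> set_option o') ` (?S t \<times> insert None (Some ` V))"
  proof
    fix Y assume Y: "Y \<in> ?S (Suc t)"
    show "Y \<in> (\<lambda>(Y, o'). Y \<union> set_option o') ` (?S t \<times> insert None (Some ` V))"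
    proof (cases "Y = {}")
      case True
      then show ?thesis by (intro image_eqI[of _ _ "({}, None)"]) auto
    next
      case False
      then obtain y where y: "y \<in> Y" by blast
      have "card (Y - {y}) \<le> t" using Y y by (auto simp: card_Diff_singleton)
      then show ?thesis using Y y by (intro image_eqI[of _ _ "(Y - {y}, Some y)"]) auto
    qed
  qed
  then have "card (?S (Suc t)) \<le> card ((\<lambda>(Y, o'). Y \<union> set_option o') ` (?S t \<times> insert None (Some ` V)))"
    using fin assms by (intro card_mono) auto
  also have "\<dots> \<le> card (?S t \<times> insert None (Some ` V))"
    using fin assms by (intro card_image_le) auto
  also have "\<dots> = card (?S t) * (card V + 1)"
    using assms by (simp add: card_cartesian_product card_image)
  also have "\<dots> \<le> (card V + 1) ^ t * (card V + 1)" by (rule mult_right_mono[OF Suc.IH]) simp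
  finally show ?case by (simp add: mult.commute)
qed

section \<open>Large clusters after deletion of a separator\<close>

definition big_clusters :: "nat \<Rightarrow> nat \<Rightarrow> bool list set set \<Rightarrow> bool list set \<Rightarrow> bool list set set" where
  "big_clusters d m F Y = {C. \<exists>x\<in>cube_vertices d - Y.
     C = cluster (restr F (cube_vertices d - Y)) {x} \<and> m \<le> card C}"

lemma big_clusters_subset: "C \<in> big_clusters d m F Y \<Longrightarrow> C \<subseteq> cube_vertices d - Y"
  unfolding big_clusters_def using cluster_restr_subset by (elim CollectE bexE conjE) (simp only:)

lemma finite_big_clusters: "finite (big_clusters d m F Y)"
  by (rule finite_subset[of _ "Pow (cube_vertices d)"]) (use big_clusters_subset in \<open>blast, simp\<close>)

lemma big_clusters_disjoint:
  assumes "C \<in> big_clusters d m F Y" "C' \<in> big_clusters d m F Y" "x \<in> C" "x \<in> C'"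
  shows "C = C'"
proof -
  have "cluster (restr F (cube_vertices d - Y)) {x} = D" if D: "D \<in> big_clusters d m F Y" "x \<in> D" for D
    using D cluster_eq[of x "restr F (cube_vertices d - Y)"] unfolding big_clusters_def by auto
  then show ?thesis using assms by metis
qed

lemma card_big_clusters: "m * card (big_clusters d m F Y) \<le> 2 ^ d"
proof -
  let ?B = "big_clusters d m F Y"
  have fin: "finite C" if "C \<in> ?B" for C
    using big_clusters_subset[OF that] finite_cube_vertices finite_subset by blast
  have "m * card ?B = (\<Sum>C\<in>?B. m)" by simp
  also have "\<dots> \<le> (\<Sum>C\<in>?B. card C)" by (intro sum_mono) (auto simp: big_clusters_def)
  also have "\<dots> = card (\<Union>?B)"
  proof (intro card_Union_disjoint[symmetric] pairwiseI fin)
    show "disjnt C C'" if "C \<in> ?B" "C' \<in> ?B" "C \<noteq> C'" for C C'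
      using big_clusters_disjoint[OF that(1,2)] that(3) by (auto simp: disjnt_def)
  qed
  also have "\<dots> \<le> card (cube_vertices d)"
    using big_clusters_subset by (intro card_mono) (simp, blast)
  finally show ?thesis by (simp add: card_cube_vertices)
qed

text \<open>A vertex outside \<open>Y\<close> whose cluster falls below size \<open>m\<close> when
  \<open>Y\<close> is deleted lies in a small remaining cluster joined to \<open>Y\<close> by an
  edge of \<open>F\<close>. The degrees in \<open>Y\<close> bound the number of such clusters, and
  each has fewer than \<open>m\<close> vertices.\<close>

lemma card_not_in_big_clusters:
  assumes "F \<subseteq> cube_edges d" "Y \<subseteq> cube_vertices d"
  shows "card (large d m F - \<Union>(big_clusters d m F Y)) \<le> card Y + m * (\<Sum>y\<in>Y. open_degree d F y)"
proof -
  let ?V = "cube_vertices d"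
  let ?H = "restr F (?V - Y)"
  have finY: "finite Y" using assms(2) finite_cube_vertices by (rule finite_subset)
  define I where "I = (\<lambda>y. {i. i < d \<and> {y, flip y i} \<in> F})"
  define K where "K = (\<lambda>z. if card (cluster ?H {z}) < m then cluster ?H {z} else {})"
  have fin: "finite (I y)" "finite (K z)" for y z
  proof -
    show "finite (I y)" by (simp add: I_def)
    have "\<Union>?H \<subseteq> ?V" by (auto simp: restr_def)
    then have "finite (\<Union>?H)" by (rule finite_subset) simp
    then show "finite (K z)" by (simp add: K_def finite_cluster)
  qed
  have cardK: "card (K z) \<le> m" for z by (simp add: K_def)
  have "large d m F - \<Union>(big_clusters d m F Y) \<subseteq> Y \<union> (\<Union>y\<in>Y. \<Union>i\<in>I y. K (flip y i))"
  proof
    fix x assume x: "x \<in> large d m F - \<Union>(big_clusters d m F Y)"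
    show "x \<in> Y \<union> (\<Union>y\<in>Y. \<Union>i\<in>I y. K (flip y i))"
    proof (cases "x \<in> Y")
      case False
      then have xV: "x \<in> ?V - Y" and mx: "m \<le> card (cluster F {x})" using x by (auto simp: large_def)
      let ?K = "cluster ?H {x}"
      have KV: "?K \<subseteq> ?V - Y" using xV by (rule cluster_restr_subset)
      have finK: "finite ?K" using KV finite_cube_vertices finite_subset by blast
      have small: "card ?K < m"
      proof (rule ccontr)
        assume "\<not> ?thesis"
        then have "?K \<in> big_clusters d m F Y" using xV by (auto simp: big_clusters_def)
        then show False using x cluster_self[of x ?H] by blast
      qed
      have "\<not> cluster F {x} \<subseteq> ?K"
        using mx small card_mono[OF finK, of "cluster F {x}"] by linarith
      then obtain z y where zy: "z \<in> ?K" "{z, y} \<in> F" "y \<notin> ?K"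
        using cluster_least[of "{x}" ?K F] cluster_self[of x ?H] by blast
      have yz: "{y, z} \<in> cube_edges d" using zy(2) assms(1) by (auto simp: insert_commute)
      have "{z, y} \<notin> ?H" using cluster_closed[OF zy(1), of y] zy(3) by blast
      then have yY: "y \<in> Y" using zy KV cube_edgesD(1)[OF yz] by (auto simp: restr_def)
      obtain i where i: "i < d" "z = flip y i" using cube_edgesD(2)[OF yz] by blast
      have "i \<in> I y" using i zy(2) by (simp add: I_def insert_commute)
      moreover have "x \<in> K (flip y i)"
        using small cluster_eq[OF zy(1)] by (simp add: K_def flip: i(2))
      ultimately show ?thesis using yY by blast
    qed simp
  qed
  then have "card (large d m F - \<Union>(big_clusters d m F Y)) \<le> card (Y \<union> (\<Union>y\<in>Y. \<Union>i\<in>I y. K (flip y i)))"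
    using finY fin by (intro card_mono) auto
  also have "\<dots> \<le> card Y + card (\<Union>y\<in>Y. \<Union>i\<in>I y. K (flip y i))" by (rule card_Un_le)
  also have "card (\<Union>y\<in>Y. \<Union>i\<in>I y. K (flip y i)) \<le> (\<Sum>y\<in>Y. card (\<Union>i\<in>I y. K (flip y i)))"
    by (rule card_UN_le[OF finY])
  also have "\<dots> \<le> (\<Sum>y\<in>Y. \<Sum>i\<in>I y. card (K (flip y i)))"
    by (intro sum_mono card_UN_le fin)
  also have "\<dots> \<le> (\<Sum>y\<in>Y. \<Sum>i\<in>I y. m)" by (intro sum_mono cardK)
  also have "\<dots> = m * (\<Sum>y\<in>Y. open_degree d F y)"
    by (simp add: I_def open_degree_def sum_distrib_left mult.commute)
  finally show ?thesis by simp
qed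

text \<open>The index set of the union bound. It depends on the first-round graph only, so the
  second round is independent of it.\<close>

definition splits :: "nat \<Rightarrow> nat \<Rightarrow> bool list set set \<Rightarrow> nat \<Rightarrow> real \<Rightarrow> (bool list set \<times> bool list set set) set" where
  "splits d m F t s = (SIGMA Y:{Y. Y \<subseteq> cube_vertices d \<and> card Y \<le> t}.
     {\<A>. \<A> \<subseteq> big_clusters d m F Y \<and> s \<le> card (\<Union>\<A>) \<and> s \<le> card (\<Union>(big_clusters d m F Y - \<A>))})"

lemma finite_splits: "finite (splits d m F t s)"
  unfolding splits_def by (intro finite_SigmaI) (auto simp: finite_big_clusters)

text \<open>There are at most \<open>(2 ^ d + 1) ^ t\<close> sets \<open>Y\<close>, and for each at
  most \<open>2 ^ d / m\<close> big clusters to distribute.\<close>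

lemma card_splits:
  assumes "0 < m"
  shows "real (card (splits d m F t s)) \<le> (2 ^ d + 1) ^ t * 2 powr (2 ^ d / m)"
proof -
  let ?S = "{Y. Y \<subseteq> cube_vertices d \<and> card Y \<le> t}"
  have 1: "real (card {\<A>. \<A> \<subseteq> big_clusters d m F Y \<and> P \<A>}) \<le> 2 powr (2 ^ d / m)" for Y P
  proof -
    have "card {\<A>. \<A> \<subseteq> big_clusters d m F Y \<and> P \<A>} \<le> card (Pow (big_clusters d m F Y))"
      by (intro card_mono) (auto simp: finite_big_clusters)
    then have "real (card {\<A>. \<A> \<subseteq> big_clusters d m F Y \<and> P \<A>}) \<le> real (2 ^ card (big_clusters d m F Y))"
      by (simp only: card_Pow[OF finite_big_clusters] of_nat_le_iff)
    also have "\<dots> = 2 powr (card (big_clusters d m F Y))" by (simp add: powr_realpow)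
    also have "\<dots> \<le> 2 powr (2 ^ d / m)"
    proof -
      have "real (m * card (big_clusters d m F Y)) \<le> real (2 ^ d)"
        by (simp only: card_big_clusters of_nat_le_iff)
      then have "real (card (big_clusters d m F Y)) \<le> 2 ^ d / m"
        using assms by (simp add: field_simps)
      then show ?thesis by simp
    qed
    finally show ?thesis .
  qed
  have "real (card (splits d m F t s)) = (\<Sum>Y\<in>?S. real (card {\<A>. \<A> \<subseteq> big_clusters d m F Y \<and>
      s \<le> card (\<Union>\<A>) \<and> s \<le> card (\<Union>(big_clusters d m F Y - \<A>))}))"
    unfolding splits_def by (subst card_SigmaI) (auto simp: finite_big_clusters)
  also have "\<dots> \<le> (\<Sum>Y\<in>?S. 2 powr (2 ^ d / m))" by (intro sum_mono 1)
  also have "\<dots> = card ?S * 2 powr (2 ^ d / m)" by simp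
  also have "\<dots> \<le> (2 ^ d + 1) ^ t * 2 powr (2 ^ d / m)"
  proof (intro mult_right_mono)
    have "real (card ?S) \<le> real ((card (cube_vertices d) + 1) ^ t)"
      by (simp only: card_small_subsets[OF finite_cube_vertices] of_nat_le_iff)
    then show "real (card ?S) \<le> (2 ^ d + 1) ^ t" by (simp add: card_cube_vertices add.commute)
  qed simp
  finally show ?thesis .
qed

text \<open>A separator \<open>W\<close> of the combined graph has a neighbourhood \<open>Y\<close>
  of size at most \<open>t\<close>. The big first-round clusters avoiding \<open>Y\<close> fall
  inside or outside of \<open>W\<close>, and no second-round connection joins the two kinds.\<close>

lemma no_long_cycle_not_linked:
  fixes s z :: real
  assumes F: "F1 \<subseteq> cube_edges d" "F2 \<subseteq> cube_edges d"
    and t: "1 \<le> t" and no: "\<And>vs. is_cycle (F1 \<union> F2) vs \<Longrightarrow> length vs \<le> t"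
    and z: "\<And>Y. Y \<subseteq> cube_vertices d \<Longrightarrow> card Y \<le> t \<Longrightarrow> card Y + m * (\<Sum>y\<in>Y. open_degree d F1 y) \<le> z"
    and s: "4 * (s + z) + 1 \<le> card (large d m F1)"
  shows "\<exists>(Y, \<A>)\<in>splits d m F1 t s. \<not> linked F2 Y (\<Union>\<A>) (\<Union>(big_clusters d m F1 Y - \<A>))"
proof -
  let ?V = "cube_vertices d"
  define U where "U = large d m F1"
  have UV: "U \<subseteq> ?V" by (auto simp: U_def large_def)
  then have finU: "finite U" by (rule finite_subset) simp
  define k where "k = card U div 2"
  have FV: "e \<subseteq> ?V" if "e \<in> F1 \<union> F2" for e
    using that F by (auto simp: cube_edges_eq dir_edges_def)
  have "k \<le> card (?V \<inter> U)" using UV by (simp add: Int_absorb1 k_def)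
  then obtain W where W: "W \<subseteq> ?V" "cyclic_separator (F1 \<union> F2) U k W"
    using cyclic_separator_exists[OF finite_cube_vertices FV] by blast
  \<comment> \<open>The neighbourhood is taken in the union of both rounds, so that neither the
    clusters of \<open>F1\<close> nor connections in \<open>F2\<close> can cross it.\<close>
  define Y where "Y = nbhd (F1 \<union> F2) W"
  have YV: "Y \<subseteq> ?V" using FV by (auto simp: Y_def nbhd_def)
  have cardY: "card Y \<le> t"
    using W(2) t no unfolding cyclic_separator_def Y_def by fastforce
  define \<B> where "\<B> = big_clusters d m F1 Y"
  define \<A> where "\<A> = {C \<in> \<B>. C \<subseteq> W}"
  \<comment> \<open>A cluster that avoids \<open>Y\<close> and meets \<open>W\<close> can never
    leave \<open>W\<close>.\<close>
  have dich: "C \<inter> W = {}" if "C \<in> \<B> - \<A>" for C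
  proof (rule ccontr)
    assume "C \<inter> W \<noteq> {}"
    then obtain x where x: "x \<in> C" "x \<in> W" by blast
    let ?H = "restr F1 (?V - Y)"
    have C: "C = cluster ?H {x}"
      using that x(1) cluster_eq[of x ?H] by (fastforce simp: \<B>_def big_clusters_def)
    have "cluster ?H {x} \<subseteq> W"
    proof (rule cluster_least)
      fix a b assume "a \<in> W" "{a, b} \<in> ?H"
      then have "{a, b} \<in> F1 \<union> F2" "b \<notin> Y" by (auto simp: restr_def)
      then show "b \<in> W" using \<open>a \<in> W\<close> by (auto simp: Y_def nbhd_def)
    qed (use x in simp)
    then show False using that C by (auto simp: \<A>_def)
  qed
  define Z where "Z = U - \<Union>\<B>"
  have finZ: "finite Z" using finU by (simp add: Z_def)
  have finB: "finite (\<Union>\<B>)"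
    using big_clusters_subset[of _ d m F1 Y] unfolding \<B>_def
    by (intro finite_subset[OF _ finite_cube_vertices[of d]]) blast
  have "card Z \<le> card Y + m * (\<Sum>y\<in>Y. open_degree d F1 y)"
    unfolding Z_def U_def \<B>_def by (rule card_not_in_big_clusters[OF F(1) YV])
  then have cardZ: "card Z \<le> z" using z[OF YV cardY] by linarith
  have AW: "\<Union>\<A> \<subseteq> W" by (auto simp: \<A>_def)
  have BW: "\<Union>(\<B> - \<A>) \<inter> W = {}" using dich by blast
  have finAB: "finite (\<Union>\<A>)" "finite (\<Union>(\<B> - \<A>))"
    using finB by (auto intro: finite_subset[OF _ finB] simp: \<A>_def)
  have "W \<inter> U \<subseteq> \<Union>\<A> \<union> Z" using BW by (auto simp: Z_def)
  then have "card (W \<inter> U) \<le> card (\<Union>\<A> \<union> Z)" using finAB finZ by (intro card_mono) auto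
  also have "\<dots> \<le> card (\<Union>\<A>) + card Z" by (rule card_Un_le)
  finally have A: "card (W \<inter> U) \<le> card (\<Union>\<A>) + card Z" .
  have "U - W \<subseteq> \<Union>(\<B> - \<A>) \<union> Z" using AW by (auto simp: Z_def)
  then have "card (U - W) \<le> card (\<Union>(\<B> - \<A>) \<union> Z)" using finAB finZ by (intro card_mono) auto
  also have "\<dots> \<le> card (\<Union>(\<B> - \<A>)) + card Z" by (rule card_Un_le)
  finally have B: "card (U - W) \<le> card (\<Union>(\<B> - \<A>)) + card Z" .
  have UW: "card U = card (W \<inter> U) + card (U - W)"
    using finU card_Diff_subset_Int[of U W] by (metis Int_commute card_Int_Diff finite_Int)
  have k: "k \<le> 2 * card (W \<inter> U)" "card (W \<inter> U) \<le> k" "2 * k \<le> card U" "card U \<le> 2 * k + 1"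
    using W(2) by (auto simp: cyclic_separator_def k_def)
  \<comment> \<open>Both sides of \<open>W\<close> keep at least
    \<open>(card U - 1) / 4 \<ge> s + z\<close> vertices of \<open>U\<close>; the \<open>+ 1\<close>
    in the hypothesis pays for the rounding in \<open>k\<close>. At most \<open>z\<close> of them
    are uncovered.\<close>
  have "s \<le> card (\<Union>\<A>)" using A k(1,4) s cardZ by (simp flip: U_def)
  moreover have "s \<le> card (\<Union>(\<B> - \<A>))" using B UW k(2,3) s cardZ by (simp flip: U_def)
  ultimately have "(Y, \<A>) \<in> splits d m F1 t s"
    using YV cardY by (auto simp: splits_def \<A>_def \<B>_def)
  moreover have "\<not> linked F2 Y (\<Union>\<A>) (\<Union>(\<B> - \<A>))"
    unfolding Y_def
  proof (rule not_linked_nbhd[OF AW BW])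
    show "\<Union>(\<B> - \<A>) \<inter> nbhd (F1 \<union> F2) W = {}"
      using big_clusters_subset unfolding \<B>_def Y_def[symmetric] by blast
  qed simp
  ultimately show ?thesis unfolding \<B>_def by blast
qed

text \<open>It remains to bound the exceptional set \<open>X\<close> in \<open>linked_prob\<close>.
  Outside of \<open>Y\<close>, a vertex of \<open>X\<close> is atypical or has at least
  \<open>k / 2\<close> neighbours in the uncovered part \<open>Z\<close> of
  \<open>U\<close>.\<close>

lemma split_linked_prob:
  fixes p s c k z \<alpha> :: real
  assumes p: "0 \<le> p" "p \<le> 1" and d: "0 < d" and F: "F1 \<subseteq> cube_edges d"
    and split: "(Y, \<A>) \<in> splits d m F1 t s"
    and \<alpha>: "card (atypical d m k F1) \<le> \<alpha>"
    and z: "\<And>Y. Y \<subseteq> cube_vertices d \<Longrightarrow> card Y \<le> t \<Longrightarrow> card Y + m * (\<Sum>y\<in>Y. open_degree d F1 y) \<le> z"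
    and h: "4 * real h \<le> k" "0 < k" and s: "2 * (d * (t + \<alpha> + 2 * real d * z / k)) \<le> s"
    and c: "0 \<le> c" "c \<le> 1 - (1 - p) ^ h"
  shows "pexp p (cube_edges d) (\<lambda>F. of_bool (\<not> linked F Y (\<Union>\<A>) (\<Union>(big_clusters d m F1 Y - \<A>))))
    \<le> exp (- (p * c\<^sup>2 * s / (4 * real d)))"
proof -
  let ?V = "cube_vertices d"
  define U where "U = large d m F1"
  define \<B> where "\<B> = big_clusters d m F1 Y"
  define A where "A = \<Union>\<A>"
  define B where "B = \<Union>(\<B> - \<A>)"
  define Z where "Z = U - (A \<union> B)"
  have Y: "Y \<subseteq> ?V" "card Y \<le> t" and \<A>: "\<A> \<subseteq> \<B>" and sAB: "s \<le> card A" "s \<le> card B"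
    using split by (auto simp: splits_def \<B>_def A_def B_def)
  have AB: "A \<union> B = \<Union>\<B>" using \<A> by (auto simp: A_def B_def)
  have ABV: "\<Union>\<B> \<subseteq> ?V - Y" using big_clusters_subset unfolding \<B>_def by blast
  have dis: "A \<inter> B = {}"
    using \<A> big_clusters_disjoint unfolding A_def B_def \<B>_def by fast
  have "card Z \<le> card Y + m * (\<Sum>y\<in>Y. open_degree d F1 y)"
    unfolding Z_def U_def AB \<B>_def by (rule card_not_in_big_clusters[OF F Y(1)])
  then have cardZ: "card Z \<le> z" using z[OF Y] by linarith
  have ZV: "Z \<subseteq> ?V" by (auto simp: Z_def U_def large_def)
  define N where "N = (\<lambda>w A. card (nbrs_in d w A))"
  define X where "X = {w \<in> ?V - (A \<union> B). w \<in> Y \<or> N w A < h \<and> N w B < h}"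
  define T where "T = {w \<in> ?V. k / 2 \<le> N w Z}"
  \<comment> \<open>Double counting of the pairs of adjacent vertices with one in \<open>T\<close>
    and the other in \<open>Z\<close>.\<close>
  have "card T * (k / 2) \<le> d * card Z"
  proof -
    have "card T * (k / 2) = (\<Sum>w\<in>T. k / 2)" by simp
    also have "\<dots> \<le> (\<Sum>w\<in>T. real (N w Z))" by (intro sum_mono) (simp add: T_def)
    also have "\<dots> \<le> (\<Sum>w\<in>?V. real (N w Z))" by (intro sum_mono2) (auto simp: T_def)
    also have "\<dots> = real (\<Sum>w\<in>?V. N w Z)" by simp
    also have "\<dots> = d * card Z" unfolding N_def sum_card_nbrs_in[OF ZV] by simp
    finally show ?thesis .
  qed
  also have "\<dots> \<le> d * z" unfolding of_nat_mult using cardZ by (intro mult_left_mono) auto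
  finally have cardT: "card T \<le> 2 * real d * z / k" using h by (simp add: field_simps)
  \<comment> \<open>Fewer than \<open>h \<le> k / 4\<close> neighbours in each of \<open>A\<close>
    and \<open>B\<close> and fewer than \<open>k / 2\<close> in \<open>Z\<close> add up to fewer
    than \<open>k\<close> in \<open>U\<close>.\<close>
  have "X \<subseteq> Y \<union> (atypical d m k F1 \<union> T)"
  proof
    fix w assume w: "w \<in> X"
    show "w \<in> Y \<union> (atypical d m k F1 \<union> T)"
    proof (rule ccontr)
      assume n: "\<not> ?thesis"
      then have small: "N w A < h" "N w B < h" "N w Z < k / 2" and wU: "k \<le> N w U"
        using w by (auto simp: X_def T_def atypical_def U_def N_def)
      have "nbrs_in d w U \<subseteq> nbrs_in d w A \<union> (nbrs_in d w B \<union> nbrs_in d w Z)"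
        by (auto simp: nbrs_in_def Z_def)
      then have "N w U \<le> card (nbrs_in d w A \<union> (nbrs_in d w B \<union> nbrs_in d w Z))"
        unfolding N_def by (intro card_mono) auto
      also have "\<dots> \<le> N w A + (N w B + N w Z)"
        unfolding N_def by (meson add_left_mono card_Un_le order_trans)
      finally show False using small wU h by linarith
    qed
  qed
  then have "card X \<le> card (Y \<union> (atypical d m k F1 \<union> T))"
    by (intro card_mono) (auto simp: T_def atypical_def intro: finite_subset[OF Y(1)])
  also have "\<dots> \<le> card Y + (card (atypical d m k F1) + card T)"
    by (meson add_left_mono card_Un_le order_trans)
  finally have "card X \<le> t + \<alpha> + 2 * real d * z / k" using Y(2) \<alpha> cardT by linarith
  then have "2 * (d * real (card X)) \<le> 2 * (d * (t + \<alpha> + 2 * real d * z / k))"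
    by (intro mult_left_mono) auto
  also note s
  finally have sX: "2 * (d * real (card X)) \<le> s" .
  show ?thesis
    unfolding \<B>_def[symmetric] A_def[symmetric] B_def[symmetric]
  proof (rule linked_prob[where X = "X \<union> Y" and h = h, OF p d _ _ _ dis _ _ _ _ sAB _ c])
    have YX: "Y \<subseteq> X" using Y(1) ABV AB by (auto simp: X_def)
    then show "real (2 * (d * card (X \<union> Y))) \<le> s" using sX by (simp add: Un_absorb2)
    show "A \<subseteq> ?V" "B \<subseteq> ?V" using AB ABV by auto
    show "X \<union> Y \<subseteq> ?V" using Y by (auto simp: X_def)
    show "(X \<union> Y) \<inter> (A \<union> B) = {}" "Y \<inter> (A \<union> B) = {}" using AB ABV by (auto simp: X_def)
    show "h \<le> card (nbrs_in d w A) \<or> h \<le> card (nbrs_in d w B)" if "w \<in> ?V - A - B - (X \<union> Y)" for w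
      using that by (auto simp: X_def N_def)
  qed simp
qed

text \<open>For a fixed good first-round graph: the absence of a long cycle forces some split to
  stay unlinked, and a union bound over \<open>splits\<close> applies.\<close>

lemma sprinkled_long_cycle_prob:
  fixes p s c k z \<alpha> :: real
  assumes p: "0 \<le> p" "p \<le> 1" and d: "0 < d" and F: "F1 \<subseteq> cube_edges d" and m: "0 < m" and t: "1 \<le> t"
    and \<alpha>: "card (atypical d m k F1) \<le> \<alpha>"
    and z: "\<And>Y. Y \<subseteq> cube_vertices d \<Longrightarrow> card Y \<le> t \<Longrightarrow> card Y + m * (\<Sum>y\<in>Y. open_degree d F1 y) \<le> z"
    and h: "4 * real h \<le> k" "0 < k" and s: "2 * (d * (t + \<alpha> + 2 * real d * z / k)) \<le> s"
      "4 * (s + z) + 1 \<le> card (large d m F1)"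
    and c: "0 \<le> c" "c \<le> 1 - (1 - p) ^ h"
  shows "pexp p (cube_edges d) (\<lambda>F2. of_bool (\<not> (\<exists>vs. is_cycle (F1 \<union> F2) vs \<and> t < length vs)))
    \<le> (2 ^ d + 1) ^ t * 2 powr (2 ^ d / m) * exp (- (p * c\<^sup>2 * s / (4 * real d)))"
proof -
  let ?P = "\<lambda>(Y, \<A>) F2. \<not> linked F2 Y (\<Union>\<A>) (\<Union>(big_clusters d m F1 Y - \<A>))"
  have "pexp p (cube_edges d) (\<lambda>F2. of_bool (\<not> (\<exists>vs. is_cycle (F1 \<union> F2) vs \<and> t < length vs)))
      \<le> pexp p (cube_edges d) (\<lambda>F2. of_bool (\<exists>i\<in>splits d m F1 t s. ?P i F2))"
  proof (intro pexp_mono p)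
    fix F2 assume "F2 \<subseteq> cube_edges d"
    then have "\<exists>i\<in>splits d m F1 t s. ?P i F2" if "\<not> (\<exists>vs. is_cycle (F1 \<union> F2) vs \<and> t < length vs)"
      using no_long_cycle_not_linked[OF F _ t _ z s(2), of F2] that by (auto simp: not_less)
    then show "of_bool (\<not> (\<exists>vs. is_cycle (F1 \<union> F2) vs \<and> t < length vs)) \<le>
        (of_bool (\<exists>i\<in>splits d m F1 t s. ?P i F2) :: real)" by auto
  qed
  also have "\<dots> \<le> card (splits d m F1 t s) * exp (- (p * c\<^sup>2 * s / (4 * real d)))"
  proof (rule pexp_union_bound[OF p finite_splits])
    fix i assume "i \<in> splits d m F1 t s"
    then show "pexp p (cube_edges d) (\<lambda>F. of_bool (?P i F)) \<le> exp (- (p * c\<^sup>2 * s / (4 * real d)))"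
      using split_linked_prob[OF p d F _ \<alpha> z h s(1) c] by (cases i) simp
  qed
  also have "\<dots> \<le> (2 ^ d + 1) ^ t * 2 powr (2 ^ d / m) * exp (- (p * c\<^sup>2 * s / (4 * real d)))"
    by (intro mult_right_mono card_splits m) simp
  finally show ?thesis .
qed

subsection \<open>Asymptotics\<close>

text \<open>Each typical vertex has at least \<open>k\<close> neighbours in the large clusters, and
  each vertex there is counted \<open>d\<close> times.\<close>

lemma card_large_ge:
  fixes \<alpha> k :: real
  assumes \<alpha>: "card (atypical d m k F) \<le> \<alpha>" and d: "0 < d" and k: "0 \<le> k"
  shows "(2 ^ d - \<alpha>) * k / d \<le> card (large d m F)"
proof -
  let ?V = "cube_vertices d" and ?A = "atypical d m k F" and ?N = "\<lambda>w. card (nbrs_in d w (large d m F))"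
  have A: "?A \<subseteq> ?V" by (auto simp: atypical_def)
  have "card (?V - ?A) = 2 ^ d - card ?A"
    using A by (simp add: card_Diff_subset finite_subset[OF A] card_cube_vertices)
  moreover have "card ?A \<le> 2 ^ d" using card_mono[OF _ A] by (simp add: card_cube_vertices)
  ultimately have "(2 ^ d - \<alpha>) * k \<le> card (?V - ?A) * k"
    using \<alpha> k by (intro mult_right_mono) (auto simp: of_nat_diff)
  also have "\<dots> = (\<Sum>w\<in>?V - ?A. k)" by simp
  also have "\<dots> \<le> (\<Sum>w\<in>?V - ?A. real (?N w))" by (intro sum_mono) (auto simp: atypical_def)
  also have "\<dots> \<le> (\<Sum>w\<in>?V. real (?N w))" by (intro sum_mono2) auto
  also have "\<dots> = real (\<Sum>w\<in>?V. ?N w)" by simp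
  also have "\<dots> = d * card (large d m F)"
    by (subst sum_card_nbrs_in) (auto simp: large_def)
  finally show ?thesis using d by (simp add: field_simps)
qed

text \<open>Sum the inequality \<open>x \<le> D + exp (x - D)\<close> over \<open>Y\<close>. With
  \<open>D\<close> of order \<open>ln d\<close> this is much better than the trivial bound
  \<open>d\<close> per vertex.\<close>

lemma sum_degree_le:
  fixes D S :: real
  assumes "Y \<subseteq> cube_vertices d" "card Y \<le> t" "0 \<le> D"
    and "(\<Sum>x\<in>cube_vertices d. exp (open_degree d F x)) \<le> S"
  shows "(\<Sum>y\<in>Y. open_degree d F y) \<le> t * D + S * exp (- D)"
proof -
  have "real (\<Sum>y\<in>Y. open_degree d F y) = (\<Sum>y\<in>Y. real (open_degree d F y))" by simp
  also have "\<dots> \<le> (\<Sum>y\<in>Y. D + exp (open_degree d F y) * exp (- D))"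
  proof (rule sum_mono)
    fix y
    have "1 + (open_degree d F y - D) \<le> exp (open_degree d F y - D)" by (rule exp_ge_add_one_self)
    then have "open_degree d F y \<le> D + exp (open_degree d F y - D)" by linarith
    then show "real (open_degree d F y) \<le> D + exp (open_degree d F y) * exp (- D)"
      by (simp add: mult_exp_exp)
  qed
  also have "\<dots> = card Y * D + (\<Sum>y\<in>Y. exp (open_degree d F y)) * exp (- D)"
    by (simp add: sum.distrib sum_distrib_right)
  also have "\<dots> \<le> t * D + S * exp (- D)"
  proof (intro add_mono mult_right_mono)
    have "(\<Sum>y\<in>Y. exp (open_degree d F y)) \<le> (\<Sum>x\<in>cube_vertices d. exp (real (open_degree d F x)))"
      using assms(1) by (intro sum_mono2) auto
    then show "(\<Sum>y\<in>Y. exp (open_degree d F y)) \<le> S" using assms(4) by linarith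
  qed (use assms in auto)
  finally show ?thesis .
qed

text \<open>A first-round graph is bad if it has more than \<open>\<alpha>\<close> atypical vertices
  or an exponential degree sum above \<open>2 ^ d * d\<close>. Markov's inequality bounds the two
  events by the first two terms; for the remaining graphs the sprinkling bound is the third.\<close>

lemma failure_prob_bound:
  fixes p p1 p2 r k \<alpha> z s c D :: real and d m n n0 h t :: nat
  assumes p1: "0 \<le> p1" "p1 \<le> 1" and p2: "0 \<le> p2" "p2 \<le> 1" and p: "1 - p = (1 - p1) * (1 - p2)"
    and d: "0 < d" and t: "1 \<le> t" and m: "1 \<le> m"
    and r: "1 \<le> r" "r \<le> real n * p1" and mn: "real n + log 2 m + n0 \<le> d"
    and h: "4 * real h \<le> k" "0 < k" and \<alpha>: "0 < \<alpha>" and D: "0 \<le> D"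
    and z: "t + m * (t * D + 2 ^ d * d * exp (- D)) \<le> z"
    and s: "2 * (d * (t + \<alpha> + 2 * real d * z / k)) \<le> s" "4 * (s + z) + 1 \<le> (2 ^ d - \<alpha>) * k / d"
    and c: "0 \<le> c" "c \<le> 1 - (1 - p2) ^ h"
  shows "pexp p (cube_edges d) (\<lambda>F. of_bool (\<not> (\<exists>vs. is_cycle F vs \<and> t < length vs)))
    \<le> 2 ^ d * (2 powr k * (1/2 + 1 / (2 * r)) ^ n0) / \<alpha> + exp (2 * (d * p1)) / d
      + (2 ^ d + 1) ^ t * 2 powr (2 ^ d / m) * exp (- (p2 * c\<^sup>2 * s / (4 * real d)))"
proof -
  let ?E = "cube_edges d"
  define b where "b = (2 ^ d + 1) ^ t * 2 powr (2 ^ d / m) * exp (- (p2 * c\<^sup>2 * s / (4 * real d)))"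
  define f where "f = (\<lambda>F. real (card (atypical d m k F)))"
  define g where "g = (\<lambda>F. \<Sum>x\<in>cube_vertices d. exp (real (open_degree d F x)))"
  have b0: "0 \<le> b" by (simp add: b_def)
  have "pexp p ?E (\<lambda>F. of_bool (\<not> (\<exists>vs. is_cycle F vs \<and> t < length vs))) =
     pexp p1 ?E (\<lambda>F1. pexp p2 ?E (\<lambda>F2. of_bool (\<not> (\<exists>vs. is_cycle (F1 \<union> F2) vs \<and> t < length vs))))"
    by (rule pexp_sprinkle[symmetric]) (use p in auto)
  also have "\<dots> \<le> pexp p1 ?E (\<lambda>F1. of_bool (f F1 > \<alpha>) + (of_bool (g F1 > 2 ^ d * d) + b))"
  proof (intro pexp_mono p1)
    fix F1 assume F1: "F1 \<subseteq> ?E"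
    let ?Q = "pexp p2 ?E (\<lambda>F2. of_bool (\<not> (\<exists>vs. is_cycle (F1 \<union> F2) vs \<and> t < length vs)))"
    have Q1: "?Q \<le> 1"
    proof -
      have "?Q \<le> pexp p2 ?E (\<lambda>_. 1)" by (intro pexp_mono p2) auto
      then show ?thesis by (simp add: pexp_const)
    qed
    show "?Q \<le> of_bool (f F1 > \<alpha>) + (of_bool (g F1 > 2 ^ d * d) + b)"
    proof (cases "f F1 > \<alpha> \<or> g F1 > 2 ^ d * d")
      case True
      then show ?thesis using Q1 b0 by auto
    next
      case False
      then have fg: "card (atypical d m k F1) \<le> \<alpha>" "(\<Sum>x\<in>cube_vertices d. exp (open_degree d F1 x)) \<le> 2 ^ d * d"
        by (auto simp: f_def g_def)
      have "?Q \<le> b" unfolding b_def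
      proof (rule sprinkled_long_cycle_prob[OF p2 d F1 _ t fg(1) _ h s(1) _ c])
        show "0 < m" using m by simp
        show "4 * (s + z) + 1 \<le> card (large d m F1)"
          using s(2) card_large_ge[OF fg(1) d] h(2) by linarith
        fix Y assume Y: "Y \<subseteq> cube_vertices d" "card Y \<le> t"
        have "real (m * (\<Sum>y\<in>Y. open_degree d F1 y)) \<le> m * (t * D + 2 ^ d * d * exp (- D))"
          unfolding of_nat_mult using sum_degree_le[OF Y D fg(2)] by (intro mult_left_mono) auto
        then show "real (card Y + m * (\<Sum>y\<in>Y. open_degree d F1 y)) \<le> z"
          using Y(2) z by simp
      qed
      then show ?thesis using False by simp
    qed
  qed
  also have "\<dots> = pexp p1 ?E (\<lambda>F1. of_bool (f F1 > \<alpha>)) + (pexp p1 ?E (\<lambda>F1. of_bool (g F1 > 2 ^ d * d)) + b)"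
    by (simp only: pexp_add pexp_const[OF finite_cube_edges])
  also have "pexp p1 ?E (\<lambda>F1. of_bool (f F1 > \<alpha>)) \<le> pexp p1 ?E f / \<alpha>"
    by (rule pexp_markov) (use p1 \<alpha> in \<open>auto simp: f_def\<close>)
  also have "pexp p1 ?E f \<le> 2 ^ d * (2 powr k * (1/2 + 1 / (2 * r)) ^ n0)"
    unfolding f_def by (rule expected_atypical[OF p1 r mn m])
  also have "pexp p1 ?E (\<lambda>F1. of_bool (g F1 > 2 ^ d * d)) \<le> pexp p1 ?E g / (2 ^ d * d)"
    by (rule pexp_markov) (use p1 d in \<open>auto simp: g_def intro: sum_nonneg\<close>)
  also have "pexp p1 ?E g \<le> 2 ^ d * exp (2 * (d * p1))"
    unfolding g_def by (rule expected_exp_degree[OF p1])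
  finally show ?thesis using \<alpha> d by (simp add: b_def divide_right_mono add.assoc)
qed

section \<open>Choice of the parameters\<close>

lemma failure_prob_asymp:
  fixes \<epsilon> :: real
  assumes \<epsilon>: "\<epsilon> > 0"
  shows "\<exists>B. B \<longlonglongrightarrow> 0 \<and> (\<forall>\<^sub>F d in sequentially. (1 + \<epsilon>) / real d \<le> 1 \<and>
    pexp ((1 + \<epsilon>) / real d) (cube_edges d) (\<lambda>F. of_bool (\<not> (\<exists>vs. is_cycle F vs \<and>
      2 ^ d / (real d ^ 3 * ln (real d) ^ 3) \<le> real (length vs)))) \<le> B d)"
proof -
  define e1 where "e1 = 1 + \<epsilon> / 2"
  \<comment> \<open>\<open>r\<close> lies strictly between 1 and \<open>e1 = d * p1\<close>. Thus
    \<open>n\<close>, about \<open>(1 - \<theta>) * d\<close>, boundary edges per vertex suffice,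
    and \<open>\<theta> * d\<close> directions remain free.\<close>
  define r where "r = 1 + \<epsilon> / 4"
  define \<theta> where "\<theta> = (\<epsilon> / 4) / e1"
  define q where "q = 1/2 + 1 / (2 * r)"
  define \<mu> where "\<mu> = ln (1 / q)"
  \<comment> \<open>About \<open>\<theta> * d / 2\<close> branches, each giving a factor
    \<open>q = exp (- \<mu>)\<close>, yield \<open>exp (- 4 * L * d)\<close> up to a constant. The
    threshold \<open>k = \<beta> * d\<close> costs \<open>2 powr k = exp (L * d)\<close>, so a decay
    of \<open>exp (- 3 * L * d)\<close> is left.\<close>
  define L where "L = \<theta> / 8 * \<mu>"
  define \<beta> where "\<beta> = L / ln 2"
  \<comment> \<open>\<open>p2 \<ge> \<epsilon> / (2 * d)\<close> and
    \<open>h \<ge> \<beta> * d / 8\<close> give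
    \<open>p2 * h \<ge> \<epsilon> * \<beta> / 16\<close>.\<close>
  define c where "c = 1 - exp (- (\<epsilon> * \<beta> / 16))"
  \<comment> \<open>\<open>K * 2 ^ d / d ^ 2\<close> bounds the exponent
    \<open>p2 * c\<^sup>2 * s / (4 * d)\<close> from below for
    \<open>s = \<beta> / 8 * 2 ^ d\<close>.\<close>
  define K where "K = \<epsilon> * c\<^sup>2 * \<beta> / 64"
  have e1: "e1 > 1" and r: "r > 1" using \<epsilon> by (auto simp: e1_def r_def)
  have \<theta>: "0 < \<theta>" "r / e1 = 1 - \<theta>" using \<epsilon> e1 by (auto simp: \<theta>_def e1_def r_def field_simps)
  have q: "0 < q" "q < 1" using r by (auto simp: q_def field_simps intro: add_pos_pos)
  have \<mu>: "0 < \<mu>" using q by (simp add: \<mu>_def)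
  have L: "0 < L" using \<mu> \<theta> by (simp add: L_def)
  have \<beta>: "0 < \<beta>" using L by (simp add: \<beta>_def)
  have c: "0 < c" using \<epsilon> \<beta> by (simp add: c_def)
  have K: "0 < K" using \<epsilon> c \<beta> by (simp add: K_def)
  define T where "T = (\<lambda>d::nat. 2 ^ d / (real d ^ 3 * ln (real d) ^ 3))"
  define \<tau> where "\<tau> = (\<lambda>d::nat. 1 / (real d ^ 3 * ln (real d) ^ 3))"
  \<comment> \<open>\<open>\<tau>\<close> and \<open>\<zeta>\<close> are the bounds for
    \<open>t\<close> and \<open>z\<close> divided by \<open>2 ^ d\<close>. The choice
    \<open>D = 6 * ln d\<close> turns \<open>d * exp (- D)\<close> into
    \<open>1 / d ^ 5\<close>.\<close>
  define \<zeta> where "\<zeta> = (\<lambda>d::nat. \<tau> d + (real d ^ 2 * ln (real d) + 1) * (\<tau> d * (6 * ln (real d)) + 1 / real d ^ 5))"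
  define B where "B = (\<lambda>d::nat. real d ^ 2 * exp (- 3 * L * real d + \<mu>) + exp (2 * e1) / real d + exp (- (K / 2 * (2 ^ d / real d ^ 2))))"
  have "B \<longlonglongrightarrow> 0 + 0 + 0"
    unfolding B_def
  proof (intro tendsto_add)
    show "(\<lambda>d. real d ^ 2 * exp (- 3 * L * real d + \<mu>)) \<longlonglongrightarrow> 0" using L by real_asymp
    show "(\<lambda>d. exp (2 * e1) / real d) \<longlonglongrightarrow> 0" by real_asymp
    show "(\<lambda>d. exp (- (K / 2 * (2 ^ d / real d ^ 2)))) \<longlonglongrightarrow> 0" using K by real_asymp
  qed
  then have B0: "B \<longlonglongrightarrow> 0" by simp
  have E0: "\<forall>\<^sub>F d::nat in sequentially. 3 \<le> d" by (rule eventually_ge_at_top)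
  have E1: "\<forall>\<^sub>F d::nat in sequentially. 1 + \<epsilon> < real d" by real_asymp
  \<comment> \<open>Half of the free directions is reserved for the branches; the other half absorbs
    \<open>log 2 m\<close> and the rounding of \<open>n\<close>.\<close>
  have E2: "\<forall>\<^sub>F d::nat in sequentially. (1 - \<theta>) * real d + 1 + ln (real d ^ 2 * ln (real d) + 1) / ln 2 + \<theta> * real d / 2 \<le> real d"
    using \<theta>(1) by real_asymp
  have E3: "\<forall>\<^sub>F d::nat in sequentially. 1 \<le> 2 ^ d / (real d ^ 3 * ln (real d) ^ 3)" by real_asymp
  have E4: "\<forall>\<^sub>F d::nat in sequentially. \<beta> * real d / 8 \<le> \<beta> * real d / 4 - 1" using \<beta> by real_asymp
  \<comment> \<open>Here the order of \<open>t\<close> is decided: \<open>\<zeta> d\<close> is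
    dominated by \<open>m * t * ln d / 2 ^ d\<close>, of order \<open>1 / (d * ln d)\<close>, and
    \<open>d * \<zeta> d\<close> must tend to 0.\<close>
  have E5: "\<forall>\<^sub>F d::nat in sequentially. 2 * (real d * (\<tau> d + 1 / real d ^ 2 + 2 / \<beta> * \<zeta> d)) \<le> \<beta> / 8"
    unfolding \<zeta>_def \<tau>_def using \<beta> by real_asymp
  have E6: "\<forall>\<^sub>F d::nat in sequentially. \<beta> / 2 + 4 * \<zeta> d + 1 / 2 ^ d \<le> (1 - 1 / real d ^ 2) * \<beta>"
    unfolding \<zeta>_def \<tau>_def using \<beta> by real_asymp
  \<comment> \<open>The number of splits against the sprinkling exponent. The factor
    \<open>ln d\<close> in \<open>m\<close> makes the number of subfamilies of big clusters
    negligible.\<close>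
  have E7: "\<forall>\<^sub>F d::nat in sequentially. ln 2 * ((real d + 1) * \<tau> d + 1 / (real d ^ 2 * ln (real d))) \<le> K / 2 / real d ^ 2"
    unfolding \<tau>_def using K by real_asymp
  have "\<forall>\<^sub>F d in sequentially. (1 + \<epsilon>) / real d \<le> 1 \<and>
    pexp ((1 + \<epsilon>) / real d) (cube_edges d) (\<lambda>F. of_bool (\<not> (\<exists>vs. is_cycle F vs \<and>
      2 ^ d / (real d ^ 3 * ln (real d) ^ 3) \<le> real (length vs)))) \<le> B d"
    using E0 E1 E2 E3 E4 E5 E6 E7
  proof eventually_elim
    case (elim d)
    have d: "0 < d" "0 < real d" using elim(1) by auto
    have lnd: "1 \<le> ln (real d)"
    proof -
      have "exp 1 \<le> real d" using exp_le elim(1) by linarith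
      then show ?thesis using d by (simp add: ln_ge_iff)
    qed
    define N where "N = (2 ^ d :: real)"
    have N: "0 < N" by (simp add: N_def)
    define p where "p = (1 + \<epsilon>) / real d"
    define p1 where "p1 = e1 / real d"
    \<comment> \<open>The solution of \<open>1 - p = (1 - p1) * (1 - p2)\<close>, which is at least
      \<open>p - p1 = \<epsilon> / (2 * d)\<close>.\<close>
    define p2 where "p2 = (p - p1) / (1 - p1)"
    have pp: "p < 1" "0 \<le> p" "0 \<le> p1" "p1 < p" using elim(2) \<epsilon> d by (auto simp: p_def p1_def e1_def field_simps)
    have p2: "0 \<le> p2" "p2 \<le> 1" "1 - p = (1 - p1) * (1 - p2)"
      using pp by (auto simp: p2_def field_simps)
    have "p - p1 = \<epsilon> / (2 * d)" using d by (simp add: p_def p1_def e1_def field_simps)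
    moreover have "p - p1 \<le> p2"
      using pp mult_left_mono[OF less_imp_le[OF pp(4)] pp(3)] by (simp add: p2_def field_simps)
    ultimately have p2ge: "\<epsilon> / (2 * d) \<le> p2" by simp
    \<comment> \<open>With \<open>t\<close> the floor of \<open>T d\<close>, a length strictly above
      \<open>t\<close> is at least \<open>T d\<close>.\<close>
    define t where "t = nat \<lfloor>T d\<rfloor>"
    define m where "m = nat \<lceil>real d ^ 2 * ln (real d)\<rceil>"
    define n where "n = nat \<lceil>r / e1 * real d\<rceil>"
    define n0 where "n0 = nat \<lfloor>\<theta> * real d / 2\<rfloor>"
    define h where "h = nat \<lfloor>\<beta> * real d / 4\<rfloor>"
    have T: "1 \<le> T d" "T d = N * \<tau> d" using elim(4) by (auto simp: T_def N_def \<tau>_def)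
    have t: "1 \<le> t" "real t \<le> T d" "T d < real t + 1"
      using T(1) by (auto simp: t_def le_nat_floor intro: of_nat_floor)
    have m: "real d ^ 2 * ln (real d) \<le> real m" "real m \<le> real d ^ 2 * ln (real d) + 1"
      using d lnd unfolding m_def by (linarith | simp add: of_nat_ceiling)+
    have dl: "1 \<le> real d ^ 2 * ln (real d)"
      using mult_mono[of 1 "real d ^ 2" 1 "ln (real d)"] d lnd by simp
    have m1: "1 \<le> m" using m(1) dl by linarith
    have n: "r / e1 * real d \<le> real n" "real n \<le> r / e1 * real d + 1"
      using d r e1 unfolding n_def by (linarith | simp add: of_nat_ceiling)+
    have n0: "\<theta> * real d / 2 - 1 \<le> real n0" "real n0 \<le> \<theta> * real d / 2"
      using d \<theta> unfolding n0_def by (linarith | simp add: of_nat_floor)+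
    have h: "\<beta> * real d / 4 - 1 \<le> real h" "real h \<le> \<beta> * real d / 4"
      using d \<beta> unfolding h_def by (linarith | simp add: of_nat_floor)+
    define z where "z = N * \<zeta> d"
    define s where "s = \<beta> / 8 * N"
    have "pexp p (cube_edges d) (\<lambda>F. of_bool (\<not> (\<exists>vs. is_cycle F vs \<and> T d \<le> real (length vs))))
       \<le> pexp p (cube_edges d) (\<lambda>F. of_bool (\<not> (\<exists>vs. is_cycle F vs \<and> t < length vs)))"
    proof (intro pexp_mono)
      fix F :: "bool list set set"
      have "T d \<le> real (length vs)" if "t < length vs" for vs :: "bool list list"
        using that t(3) by linarith
      then have "(\<exists>vs. is_cycle F vs \<and> t < length vs) \<Longrightarrow> (\<exists>vs. is_cycle F vs \<and> T d \<le> real (length vs))"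
        by blast
      then show "of_bool (\<not> (\<exists>vs. is_cycle F vs \<and> T d \<le> real (length vs)))
          \<le> (of_bool (\<not> (\<exists>vs. is_cycle F vs \<and> t < length vs)) :: real)"
        unfolding of_bool_less_eq_iff by blast
    qed (use pp in auto)
    also have "\<dots> \<le> 2 ^ d * (2 powr (\<beta> * d) * (1/2 + 1 / (2 * r)) ^ n0) / (N / real d ^ 2) + exp (2 * (d * p1)) / d
      + (2 ^ d + 1) ^ t * 2 powr (2 ^ d / m) * exp (- (p2 * c\<^sup>2 * s / (4 * real d)))"
    proof (rule failure_prob_bound[where n = n and h = h and z = z and D = "6 * ln (real d)"])
      show "0 \<le> p1" "p1 \<le> 1" "0 \<le> p2" "p2 \<le> 1" "1 - p = (1 - p1) * (1 - p2)" using pp p2 by auto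
      show "0 < d" "1 \<le> t" "1 \<le> m" "1 \<le> r" using d t m1 r by auto
      have "r = r / e1 * real d * p1" using d e1 by (simp add: p1_def)
      also have "\<dots> \<le> real n * p1" using n pp by (intro mult_right_mono) auto
      finally show "r \<le> real n * p1" .
      have "log 2 (real m) \<le> log 2 (real d ^ 2 * ln (real d) + 1)"
        using m m1 by (subst log_le_cancel_iff) auto
      then show "real n + log 2 (real m) + real n0 \<le> real d"
        using elim(3) n(2) n0(2) \<theta>(2) by (simp add: log_def)
      show "4 * real h \<le> \<beta> * real d" "0 < \<beta> * real d" using h \<beta> d by auto
      show "0 < N / real d ^ 2" "0 \<le> 6 * ln (real d)" using N d lnd by auto
      have "exp (real 6 * ln (real d)) = exp (ln (real d)) ^ 6" by (rule exp_of_nat_mult)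
      then have "exp (- (6 * ln (real d))) = 1 / real d ^ Suc 5"
        using d by (simp add: exp_minus inverse_eq_divide)
      then have "2 ^ d * d * exp (- (6 * ln (real d))) = N / real d ^ 5"
        using d unfolding power_Suc by (simp add: N_def)
      then have "real t + m * (t * (6 * ln (real d)) + 2 ^ d * d * exp (- (6 * ln (real d))))
          = real t + m * (t * (6 * ln (real d)) + N / real d ^ 5)"
        by simp
      also have "\<dots> \<le> T d + (real d ^ 2 * ln (real d) + 1) * (T d * (6 * ln (real d)) + N / real d ^ 5)"
        using t m lnd N dl T(1) by (intro add_mono mult_mono) auto
      also have "\<dots> = z" by (simp add: z_def \<zeta>_def T(2) algebra_simps)
      finally show "real t + m * (t * (6 * ln (real d)) + 2 ^ d * d * exp (- (6 * ln (real d)))) \<le> z" .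
      have "2 * (d * (real t + N / real d ^ 2 + 2 * real d * z / (\<beta> * real d)))
          \<le> 2 * (d * (T d + N / real d ^ 2 + 2 * real d * z / (\<beta> * real d)))"
        using t by (intro mult_left_mono) auto
      also have "\<dots> = N * (2 * (real d * (\<tau> d + 1 / real d ^ 2 + 2 / \<beta> * \<zeta> d)))"
        using d by (simp add: T(2) z_def algebra_simps)
      also have "\<dots> \<le> N * (\<beta> / 8)" using elim(6) N by (intro mult_left_mono) auto
      finally show "2 * (d * (real t + N / real d ^ 2 + 2 * real d * z / (\<beta> * real d))) \<le> s"
        by (simp add: s_def mult.commute)
      have "4 * (s + z) + 1 = N * (\<beta> / 2 + 4 * \<zeta> d + 1 / 2 ^ d)"
        using N by (simp add: s_def z_def N_def algebra_simps)
      also have "\<dots> \<le> N * ((1 - 1 / real d ^ 2) * \<beta>)" using elim(7) N by (intro mult_left_mono) auto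
      also have "\<dots> = (2 ^ d - N / real d ^ 2) * \<beta>" by (simp add: N_def algebra_simps)
      also have "\<dots> = (2 ^ d - N / real d ^ 2) * (\<beta> * real d) / real d" using d by simp
      finally show "4 * (s + z) + 1 \<le> (2 ^ d - N / real d ^ 2) * (\<beta> * real d) / real d" .
      show "0 \<le> c" using c by simp
      have "(1 - p2) ^ h \<le> exp (- p2) ^ h"
        using p2 exp_ge_add_one_self[of "- p2"] by (intro power_mono) auto
      also have "\<dots> = exp (- (p2 * h))" by (simp flip: exp_of_nat_mult)
      also have "\<dots> \<le> exp (- (\<epsilon> * \<beta> / 16))"
      proof -
        have "\<epsilon> / (2 * d) * (\<beta> * real d / 8) \<le> p2 * h"
          using p2ge p2(1) h elim(5) \<epsilon> \<beta> d by (intro mult_mono) auto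
        then show ?thesis using d by simp
      qed
      finally show "c \<le> 1 - (1 - p2) ^ h" by (simp add: c_def)
    qed
    also have "\<dots> \<le> B d"
      unfolding B_def
    proof (intro add_mono)
      have "2 powr (\<beta> * d) = exp (L * d)" by (simp add: powr_def \<beta>_def)
      moreover have "(1/2 + 1 / (2 * r)) ^ n0 \<le> exp (- 4 * L * real d + \<mu>)"
      proof -
        have "q ^ n0 = exp (- \<mu>) ^ n0" using q by (simp add: \<mu>_def ln_div)
        also have "\<dots> = exp (- (\<mu> * n0))" by (simp flip: exp_of_nat_mult)
        also have "\<dots> \<le> exp (- (\<mu> * (\<theta> * real d / 2 - 1)))" using \<mu> n0 by simp
        also have "- (\<mu> * (\<theta> * real d / 2 - 1)) = - 4 * L * real d + \<mu>" by (simp add: L_def algebra_simps)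
        finally show ?thesis by (simp add: q_def)
      qed
      ultimately have "2 powr (\<beta> * d) * (1/2 + 1 / (2 * r)) ^ n0 \<le> exp (L * d) * exp (- 4 * L * real d + \<mu>)"
        by (simp add: mult_left_mono)
      also have "\<dots> = exp (- 3 * L * real d + \<mu>)" by (simp add: mult_exp_exp algebra_simps)
      finally have "real d ^ 2 * (2 powr (\<beta> * d) * (1/2 + 1 / (2 * r)) ^ n0) \<le> real d ^ 2 * exp (- 3 * L * real d + \<mu>)"
        by (intro mult_left_mono) auto
      then show "2 ^ d * (2 powr (\<beta> * d) * (1/2 + 1 / (2 * r)) ^ n0) / (N / real d ^ 2) \<le> real d ^ 2 * exp (- 3 * L * real d + \<mu>)"
        using d by (simp add: N_def mult_ac)
      show "exp (2 * (d * p1)) / d \<le> exp (2 * e1) / d" using d by (simp add: p1_def)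
      have "(2 ^ d + 1) ^ t \<le> ((2 ^ (d + 1)) ^ t :: real)" by (intro power_mono) auto
      also have "\<dots> = exp (ln 2) ^ ((d + 1) * t)" by (simp only: power_mult) simp
      also have "\<dots> = exp (real ((d + 1) * t) * ln 2)" by (simp only: exp_of_nat_mult)
      also have "\<dots> = exp (ln 2 * ((real d + 1) * t))" by (simp add: algebra_simps)
      also have "\<dots> \<le> exp (ln 2 * ((real d + 1) * T d))" using t by (simp add: mult_left_mono)
      finally have 1: "(2 ^ d + 1) ^ t \<le> exp (ln 2 * ((real d + 1) * T d))" .
      have "2 powr (2 ^ d / m) \<le> 2 powr (N / (real d ^ 2 * ln (real d)))"
        using m dl d lnd elim(1) by (intro powr_mono) (auto simp: N_def intro!: divide_left_mono mult_pos_pos)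
      then have 2: "2 powr (2 ^ d / m) \<le> exp (ln 2 * (N / (real d ^ 2 * ln (real d))))"
        by (simp add: powr_def mult.commute)
      have "\<epsilon> / (2 * d) * (c\<^sup>2 * s / (4 * real d)) \<le> p2 * (c\<^sup>2 * s / (4 * real d))"
        using p2ge \<beta> N by (intro mult_right_mono) (auto simp: s_def)
      moreover have "\<epsilon> / (2 * d) * (c\<^sup>2 * s / (4 * real d)) = K * N / real d ^ 2"
        using d by (simp add: s_def K_def field_simps power2_eq_square)
      ultimately have 3: "exp (- (p2 * c\<^sup>2 * s / (4 * real d))) \<le> exp (- (K * N / real d ^ 2))" by simp
      have "(2 ^ d + 1) ^ t * 2 powr (2 ^ d / m) * exp (- (p2 * c\<^sup>2 * s / (4 * real d)))
          \<le> exp (ln 2 * ((real d + 1) * T d)) * exp (ln 2 * (N / (real d ^ 2 * ln (real d)))) * exp (- (K * N / real d ^ 2))"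
        using 1 2 3 by (intro mult_mono) auto
      also have "\<dots> = exp (N * (ln 2 * ((real d + 1) * \<tau> d + 1 / (real d ^ 2 * ln (real d)))) - K * N / real d ^ 2)"
        by (simp add: mult_exp_exp T(2) algebra_simps)
      also have "\<dots> \<le> exp (N * (K / 2 / real d ^ 2) - K * N / real d ^ 2)"
        unfolding exp_le_cancel_iff
        by (intro diff_right_mono mult_left_mono elim(8)) (use N in simp)
      also have "N * (K / 2 / real d ^ 2) - K * N / real d ^ 2 = - (K / 2 * (2 ^ d / real d ^ 2))"
        using d by (simp add: N_def field_simps)
      finally show "(2 ^ d + 1) ^ t * 2 powr (2 ^ d / m) * exp (- (p2 * c\<^sup>2 * s / (4 * real d)))
          \<le> exp (- (K / 2 * (2 ^ d / real d ^ 2)))" .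
    qed
    finally show ?case using pp by (simp add: p_def T_def)
  qed
  then show ?thesis using B0 by blast
qed

theorem theorem1p2:
  fixes \<epsilon> :: real
  assumes "\<epsilon> > 0"
  shows "\<exists>c > 0. (\<lambda>d. measure_pmf.prob (random_subcube d ((1 + \<epsilon>) / real d))
            {G. \<exists>vs. is_cycle (retained_edges d G) vs \<and>
                 real (length vs) \<ge> c * 2 ^ d / (real d ^ 3 * ln (real d) ^ 3)})
         \<longlonglongrightarrow> 1"
\<comment> \<open>The constant 1 works for every \<open>\<epsilon>\<close>: the dependence on
  \<open>\<epsilon>\<close> is confined to how large \<open>d\<close> has to be and to the bound
  \<open>B\<close>.\<close>
proof (intro exI[of _ 1] conjI)
  define P where "P = (\<lambda>d. measure_pmf.prob (random_subcube d ((1 + \<epsilon>) / real d))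
            {G. \<exists>vs. is_cycle (retained_edges d G) vs \<and>
                 real (length vs) \<ge> 1 * 2 ^ d / (real d ^ 3 * ln (real d) ^ 3)})"
  obtain B where B: "B \<longlonglongrightarrow> 0" "\<forall>\<^sub>F d in sequentially. (1 + \<epsilon>) / real d \<le> 1 \<and>
    pexp ((1 + \<epsilon>) / real d) (cube_edges d) (\<lambda>F. of_bool (\<not> (\<exists>vs. is_cycle F vs \<and>
      2 ^ d / (real d ^ 3 * ln (real d) ^ 3) \<le> real (length vs)))) \<le> B d"
    using failure_prob_asymp[OF assms] by blast
  have "\<forall>\<^sub>F d in sequentially. 1 - B d \<le> P d"
    using B(2)
  proof eventually_elim
    case (elim d)
    let ?p = "(1 + \<epsilon>) / real d"
    let ?Q = "\<lambda>F. \<exists>vs. is_cycle F vs \<and> 2 ^ d / (real d ^ 3 * ln (real d) ^ 3) \<le> real (length vs)"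
    have "P d = pexp ?p (cube_edges d) (\<lambda>F. of_bool (?Q F))"
      unfolding P_def random_subcube_def retained_edges_def
      using pexp_Pi_pmf[of "cube_edges d" ?p ?Q] elim assms by simp
    also have "\<dots> = pexp ?p (cube_edges d) (\<lambda>F. 1 - of_bool (\<not> ?Q F))"
      by (intro pexp_cong) auto
    also have "\<dots> = 1 - pexp ?p (cube_edges d) (\<lambda>F. of_bool (\<not> ?Q F))"
      by (simp only: pexp_diff pexp_const[OF finite_cube_edges])
    finally show ?case using elim by linarith
  qed
  moreover have "(\<lambda>d. 1 - B d) \<longlonglongrightarrow> 1" using tendsto_diff[OF tendsto_const B(1), of 1] by simp
  ultimately show "P \<longlonglongrightarrow> 1"
    by (intro tendsto_sandwich[of "\<lambda>d. 1 - B d" P sequentially "\<lambda>_. 1"]) (auto simp: P_def)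
qed simp

end
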